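(* Let $v_{U,n}$ be the average, over a uniformly random element of $U(n,q)$, of the order of the element. For fixed prime power $q$ and growing $n$, $$\log(v_{U,n})\ \geq\ n\log(q)-\log(n)+o(\log(n)).$$
   Context: $U(n,q)$ is the subgroup of $GL(n,q^2)$ preserving a non-degenerate skew-linear form, e.g. $\langle\vec x,\vec y\rangle=\sum_{i=1}^nx_iy_i^q$ on $F_{q^2}^n$. The order of an element is its order as a group element. *)

theory Defs
  imports
    "HOL-Algebra.Multiplicative_Group"
    "HOL-Number_Theory.Prime_Powers"
    "HOL-Number_Theory.Residues"
    "HOL-Library.Landau_Symbols"
    "HOL-Library.Cardinality"
    "Jordan_Normal_Form.Matrix"
begin

text \<open>Throughout, the ground field is a finite field type \<open>'a\<close> with \<open>CARD('a) = q\<^sup>2\<close>, whose involution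
  is \<open>x \<mapsto> x ^ q\<close>; vectors of length \<open>n\<close> are the elements of \<open>carrier_vec n\<close>.\<close>

definition sesquilinear_form :: "nat \<Rightarrow> nat \<Rightarrow> ('a :: field vec \<Rightarrow> 'a vec \<Rightarrow> 'a) \<Rightarrow> bool" where
  "sesquilinear_form q n B \<longleftrightarrow>
     (\<forall>x\<in>carrier_vec n. \<forall>y\<in>carrier_vec n. \<forall>z\<in>carrier_vec n.
        B (x + y) z = B x z + B y z \<and> B x (y + z) = B x y + B x z) \<and>
     (\<forall>c. \<forall>x\<in>carrier_vec n. \<forall>y\<in>carrier_vec n.
        B (c \<cdot>\<^sub>v x) y = c * B x y \<and> B x (c \<cdot>\<^sub>v y) = c ^ q * B x y)"

definition nondegenerate_form :: "nat \<Rightarrow> ('a :: field vec \<Rightarrow> 'a vec \<Rightarrow> 'a) \<Rightarrow> bool" where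
  "nondegenerate_form n B \<longleftrightarrow>
     (\<forall>x\<in>carrier_vec n. (\<forall>y\<in>carrier_vec n. B x y = 0) \<longrightarrow> x = 0\<^sub>v n)"

text \<open>For a sesquilinear form that is not conjugate-symmetric (up to a scalar) the isometry group is in
  general not a unitary group, so conjugate symmetry is part of the notion.\<close>

definition unitary_form :: "nat \<Rightarrow> nat \<Rightarrow> ('a :: field vec \<Rightarrow> 'a vec \<Rightarrow> 'a) \<Rightarrow> bool" where
  "unitary_form q n B \<longleftrightarrow>
     sesquilinear_form q n B \<and>
     (\<forall>x\<in>carrier_vec n. \<forall>y\<in>carrier_vec n. B y x = B x y ^ q) \<and>
     nondegenerate_form n B"

definition standard_form :: "nat \<Rightarrow> nat \<Rightarrow> 'a :: field vec \<Rightarrow> 'a vec \<Rightarrow> 'a" where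
  "standard_form q n x y = (\<Sum>i<n. x $ i * (y $ i) ^ q)"

definition GL :: "nat \<Rightarrow> 'a :: field mat monoid" where
  "GL n = units_of (ring_mat TYPE('a) n ())"

definition unitary_group :: "nat \<Rightarrow> ('a :: field vec \<Rightarrow> 'a vec \<Rightarrow> 'a) \<Rightarrow> 'a mat monoid" where
  "unitary_group n B = (GL n)\<lparr>carrier := {A \<in> carrier (GL n).
     \<forall>x\<in>carrier_vec n. \<forall>y\<in>carrier_vec n. B (A *\<^sub>v x) (A *\<^sub>v y) = B x y}\<rparr>"

definition average_order :: "('g, 'b) monoid_scheme \<Rightarrow> real" where
  "average_order G = (\<Sum>g\<in>carrier G. real (group.ord G g)) / real (order G)"

text \<open>Sanity checks: the unitary group is a subgroup of the general linear group, and the standard form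
  is an instance of the notion of form above.\<close>

lemma GL_simps:
  "monoid.mult (GL n) = (*)" "monoid.one (GL n) = 1\<^sub>m n" "A \<in> carrier (GL n) \<Longrightarrow> A \<in> carrier_mat n n"
  by (auto simp: GL_def units_of_def ring_mat_def Units_def)

lemma group_GL: "group (GL n :: 'a :: field mat monoid)"
proof -
  interpret ring "ring_mat TYPE('a) n ()" by (rule ring_mat)
  show ?thesis unfolding GL_def by (rule units_group)
qed

lemma subgroup_unitary_group:
  fixes B :: "'a :: field vec \<Rightarrow> 'a vec \<Rightarrow> 'a"
  shows "subgroup (carrier (unitary_group n B)) (GL n)"
proof -
  interpret G: group "GL n :: 'a mat monoid" by (rule group_GL)
  let ?S = "carrier (unitary_group n B)"
  have mem: "A \<in> ?S \<longleftrightarrow> A \<in> carrier (GL n) \<and>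
      (\<forall>x\<in>carrier_vec n. \<forall>y\<in>carrier_vec n. B (A *\<^sub>v x) (A *\<^sub>v y) = B x y)" for A
    by (simp add: unitary_group_def)
  show ?thesis
  proof (rule G.subgroupI)
    show "?S \<subseteq> carrier (GL n)" using mem by blast
    have "\<one>\<^bsub>GL n\<^esub> \<in> ?S" unfolding mem using G.one_closed by (simp add: GL_simps)
    then show "?S \<noteq> {}" by blast
  next
    fix A assume A: "A \<in> ?S"
    then have AG: "A \<in> carrier (GL n)" using mem by blast
    let ?I = "inv\<^bsub>GL n\<^esub> A"
    have I: "?I \<in> carrier (GL n)" using AG by simp
    have AI: "A * ?I = 1\<^sub>m n" using G.r_inv[OF AG] by (simp add: GL_simps)
    have cA: "A \<in> carrier_mat n n" "?I \<in> carrier_mat n n" using AG I GL_simps by blast+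
    have k: "A *\<^sub>v (?I *\<^sub>v x) = x" if "x \<in> carrier_vec n" for x
      using that cA AI assoc_mult_mat_vec[of A n n ?I n x] by simp
    have "B (?I *\<^sub>v x) (?I *\<^sub>v y) = B x y" if xy: "x \<in> carrier_vec n" "y \<in> carrier_vec n" for x y
    proof -
      have "?I *\<^sub>v x \<in> carrier_vec n" "?I *\<^sub>v y \<in> carrier_vec n" using cA(2) xy by auto
      then have "B (A *\<^sub>v (?I *\<^sub>v x)) (A *\<^sub>v (?I *\<^sub>v y)) = B (?I *\<^sub>v x) (?I *\<^sub>v y)"
        using A mem by blast
      then show ?thesis using k xy by simp
    qed
    then show "?I \<in> ?S" using mem I by blast
  next
    fix A C assume AC: "A \<in> ?S" "C \<in> ?S"
    then have g: "A \<in> carrier (GL n)" "C \<in> carrier (GL n)" using mem by blast+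
    then have c: "A \<in> carrier_mat n n" "C \<in> carrier_mat n n" using GL_simps by blast+
    have "B ((A * C) *\<^sub>v x) ((A * C) *\<^sub>v y) = B x y" if xy: "x \<in> carrier_vec n" "y \<in> carrier_vec n" for x y
    proof -
      have "C *\<^sub>v x \<in> carrier_vec n" "C *\<^sub>v y \<in> carrier_vec n" using c(2) xy by auto
      then have "B (A *\<^sub>v (C *\<^sub>v x)) (A *\<^sub>v (C *\<^sub>v y)) = B x y" using AC mem xy by metis
      then show ?thesis using c xy by (simp add: assoc_mult_mat_vec)
    qed
    moreover have "A * C \<in> carrier (GL n)" using G.m_closed[OF g] by (simp add: GL_simps)
    ultimately show "A \<otimes>\<^bsub>GL n\<^esub> C \<in> ?S" using mem by (simp add: GL_simps)
  qed
qed

lemma unitary_form_standard_form: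
  assumes q: "primepow q" and card: "CARD('a) = q\<^sup>2"
  shows "unitary_form q n (standard_form q n :: 'a :: finite_field vec \<Rightarrow> 'a vec \<Rightarrow> 'a)"
proof -
  obtain p k where pk: "prime p" "k > 0" "q = p ^ k" using q by (auto simp: primepow_def)
  have "CHAR('a) dvd q\<^sup>2" using CHAR_dvd_CARD[where 'a = 'a] card by simp
  moreover have pC: "prime CHAR('a)" using prime_CHAR_semidom CHAR_pos by blast
  ultimately have "CHAR('a) dvd p" using pk(3) using prime_dvd_power by blast
  then have qC: "q = CHAR('a) ^ k" using pk pC primes_dvd_imp_eq by blast
  have add: "(x + y) ^ q = x ^ q + y ^ q" for x y :: 'a
    using freshmans_dream'[OF pC qC] .
  have sum: "(sum f A) ^ q = (\<Sum>i\<in>A. f i ^ q)" for f :: "nat \<Rightarrow> 'a" and A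
    using freshmans_dream_sum'[OF pC qC] .
  have inv: "(x ^ q) ^ q = x" for x :: 'a
    using finite_field_power_card_eq_same[of x] card by (simp add: power_mult[symmetric] power2_eq_square)
  let ?B = "standard_form q n :: 'a vec \<Rightarrow> 'a vec \<Rightarrow> 'a"
  have "sesquilinear_form q n ?B"
    unfolding sesquilinear_form_def
  proof (intro conjI ballI allI)
    fix x y z :: "'a vec" and c
    assume c: "x \<in> carrier_vec n" "y \<in> carrier_vec n"
    show "?B (c \<cdot>\<^sub>v x) y = c * ?B x y" "?B x (c \<cdot>\<^sub>v y) = c ^ q * ?B x y"
      using c by (simp_all add: standard_form_def sum_distrib_left power_mult_distrib mult_ac)
    assume z: "z \<in> carrier_vec n"
    show "?B (x + y) z = ?B x z + ?B y z" "?B x (y + z) = ?B x y + ?B x z"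
      using c z by (simp_all add: standard_form_def distrib_left distrib_right sum.distrib add)
  qed
  moreover have "?B y x = ?B x y ^ q" for x y
    by (simp add: standard_form_def sum power_mult_distrib inv mult.commute)
  moreover have "nondegenerate_form n ?B"
    unfolding nondegenerate_form_def
  proof (intro ballI impI)
    fix x :: "'a vec" assume x: "x \<in> carrier_vec n" and 0: "\<forall>y\<in>carrier_vec n. ?B x y = 0"
    have "q > 0" using pk prime_gt_0_nat by simp
    have "x $ i = 0" if i: "i < n" for i
    proof -
      have "?B x (unit_vec n i) = (\<Sum>j<n. if j = i then x $ j else 0)"
        unfolding standard_form_def using i \<open>q > 0\<close> by (intro sum.cong) (auto simp: power_0_left)
      then show ?thesis using 0 i by (auto simp: sum.delta)
    qed
    then show "x = 0\<^sub>v n" using x by (intro eq_vecI) auto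
  qed
  ultimately show ?thesis unfolding unitary_form_def by blast
qed

end

theory Submission
  imports
    "HOL-Algebra.Algebraic_Closure_Type"
    "HOL-Number_Theory.Number_Theory"
    "HOL-Library.Product_Plus"
    "HOL-Library.Function_Algebras"
    Defs
begin

text \<open>Let \<open>m\<close> be the odd one of \<open>n\<close>, \<open>n - 1\<close>. The field \<open>L\<close> with \<open>q\<^sup>2\<^sup>m\<close> elements, with the form
  \<open>Tr (x y ^ (q ^ m))\<close> over the field with \<open>q\<^sup>2\<close> elements, is a Hermitian space on which the cyclic group of
  \<open>q ^ m + 1\<close> elements of norm one acts by multiplication. As Hermitian spaces over a finite field are
  classified by their dimension, \<open>L\<close>, or \<open>L\<close> plus a line, is isometric to any given space of dimension \<open>n\<close>.
  A generator \<open>u\<close> of the cyclic group has a centralizer of order at most \<open>(q ^ m + 1) q\<^sup>2\<close>, and at most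
  \<open>m\<close> of the generators are conjugate to \<open>u\<close>, since they are roots of its minimal polynomial. Counting
  the conjugates of the generators, all of order \<open>q ^ m + 1\<close>, bounds the average order from below by
  \<open>\<phi>(q ^ m + 1) / (m q\<^sup>2)\<close>. Finally \<open>\<phi>(N) / N\<close> is at least \<open>(ln N) powr - o(1)\<close>, because
  \<open>\<Sum>\<^sub>p\<^sub>\<le>\<^sub>y 1/p = o(ln y)\<close> and \<open>N\<close> has at most \<open>ln N / ln 2\<close> prime factors.\<close>


subsection \<open>The totient function\<close>

text \<open>The order \<open>q ^ m + 1\<close> of the torus elements cancels against the same factor
  in the centralizer bound. The main term therefore comes from the number of generators, and the
  loss of \<open>ln n\<close> from the at most \<open>m\<close> generators in one class; all other
  losses are constant factors depending on \<open>q\<close>, or the ratio of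
  \<open>totient N\<close> to \<open>N\<close>. Oddness of \<open>m\<close> is forced: for even
  \<open>m\<close> the map \<open>x ^ (q ^ m)\<close> fixes the ground field pointwise, and the
  trace form would be linear in both arguments. A type cannot vary with \<open>n\<close>, so the
  fields \<open>L\<close> for all \<open>m\<close> are sets of Frobenius fixed points in one
  algebraic closure, and dimension is expressed by the number of elements. Spanning and surjectivity
  then follow by counting, and most upper bounds are counts of roots of explicit polynomials. For
  the totient a sharp Mertens estimate would be more than required. The threshold \<open>T\<close>
  for the primes is free, and choosing it according to the precision wanted in the definition of
  little-o is enough.\<close>

lemma sum_ln_prime_factors_le:
  fixes m :: nat
  assumes "m > 0"
  shows "(\<Sum>p\<in>prime_factors m. ln (real p)) \<le> ln (real m)"
proof -
  have pos: "real p > 0" if "p \<in> prime_factors m" for p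
    using that prime_gt_0_nat by auto
  have "(\<Prod>p\<in>prime_factors m. p) \<le> (\<Prod>p\<in>prime_factors m. p ^ multiplicity p m)"
  proof (rule prod_mono)
    fix p assume p: "p \<in> prime_factors m"
    then have "multiplicity p m > 0" "p > 0"
      using assms by (auto simp: prime_factors_multiplicity prime_gt_0_nat)
    then show "0 \<le> p \<and> p \<le> p ^ multiplicity p m" by (simp add: self_le_power)
  qed
  also have "\<dots> = m" using prime_factorization_nat[OF assms] by (rule sym)
  finally have "(\<Prod>p\<in>prime_factors m. real p) \<le> real m"
    using of_nat_mono[of "\<Prod>p\<in>prime_factors m. p" m, where ?'a = real] by simp
  moreover have "(\<Sum>p\<in>prime_factors m. ln (real p)) = ln (\<Prod>p\<in>prime_factors m. real p)"
    using pos by (intro ln_prod[symmetric]) auto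
  moreover have "(\<Prod>p\<in>prime_factors m. real p) > 0" using pos by (intro prod_pos) auto
  ultimately show ?thesis using assms by simp
qed

text \<open>Pairs \<open>(p, m)\<close> with \<open>p dvd m\<close> and \<open>m \<le> y\<close>,
  weighted by \<open>ln p\<close>, are counted in two ways: each prime \<open>p \<le> y\<close> has
  at least \<open>y / (2 * p)\<close> multiples up to \<open>y\<close>, and each \<open>m\<close>
  carries total weight at most \<open>ln m\<close>.\<close>

lemma sum_ln_over_primes_le:
  fixes y :: nat
  assumes "y \<ge> 1"
  shows "(\<Sum>p | prime p \<and> p \<le> y. ln (real p) / real p) \<le> 2 * ln (real y)"
proof -
  let ?P = "{p. prime p \<and> p \<le> y}"
  have fin: "finite ?P" by simp
  have "(\<Sum>p\<in>?P. ln (real p) * (real y / (2 * real p))) \<le> (\<Sum>p\<in>?P. ln (real p) * card {m\<in>{1..y}. p dvd m})"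
  proof (intro sum_mono mult_left_mono)
    fix p assume p: "p \<in> ?P"
    then have p0: "p > 0" using prime_gt_0_nat by auto
    have "(\<lambda>k. p * k) ` {1..y div p} \<subseteq> {m\<in>{1..y}. p dvd m}"
      using p0 by (auto simp: less_eq_div_iff_mult_less_eq mult.commute)
    then have "card ((\<lambda>k. p * k) ` {1..y div p}) \<le> card {m\<in>{1..y}. p dvd m}"
      by (intro card_mono) auto
    moreover have "card ((\<lambda>k. p * k) ` {1..y div p}) = y div p"
      using p0 by (subst card_image) (auto simp: inj_on_def)
    ultimately have "y div p \<le> card {m\<in>{1..y}. p dvd m}" by simp
    \<comment> \<open>The quotient is at least one, so the remainder is below
      \<open>p * (y div p)\<close>: rounding down costs at most the factor 2.\<close>
    moreover have "y \<le> 2 * p * (y div p)"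
    proof -
      have "y = p * (y div p) + y mod p" by simp
      moreover have "y mod p < p" using p0 by simp
      moreover have "y div p \<ge> 1" using p p0 by (simp add: Suc_leI div_greater_zero_iff)
      then have "p \<le> p * (y div p)" using p0 by simp
      ultimately show ?thesis by linarith
    qed
    ultimately have "y \<le> 2 * p * card {m\<in>{1..y}. p dvd m}"
      by (meson le_trans mult_le_mono2)
    then have "real y \<le> real (2 * p * card {m\<in>{1..y}. p dvd m})" by (rule of_nat_mono)
    then show "real y / (2 * real p) \<le> real (card {m\<in>{1..y}. p dvd m})"
      using p0 by (simp add: divide_le_eq mult_ac)
    show "ln (real p) \<ge> 0" using p0 by simp
  qed
  also have "\<dots> = (\<Sum>p\<in>?P. \<Sum>m\<in>{1..y}. if p dvd m then ln (real p) else 0)"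
    by (intro sum.cong) (auto simp: sum.If_cases Int_def)
  also have "\<dots> = (\<Sum>m\<in>{1..y}. \<Sum>p\<in>?P. if p dvd m then ln (real p) else 0)"
    by (rule sum.swap)
  also have "\<dots> \<le> (\<Sum>m\<in>{1..y}. ln (real y))"
  proof (rule sum_mono)
    fix m assume m: "m \<in> {1..y}"
    have "?P \<inter> {p. p dvd m} = prime_factors m"
    proof (intro equalityI subsetI)
      fix p assume "p \<in> prime_factors m"
      then have "prime p" "p dvd m" by auto
      moreover have "p \<le> m" using \<open>p dvd m\<close> m by (intro dvd_imp_le) auto
      ultimately show "p \<in> ?P \<inter> {p. p dvd m}" using m by auto
    qed (use m in \<open>auto simp: prime_factors_dvd\<close>)
    then have "(\<Sum>p\<in>?P. if p dvd m then ln (real p) else 0) = (\<Sum>p\<in>prime_factors m. ln (real p))"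
      using sum.inter_restrict[OF fin, of "\<lambda>p. ln (real p)" "{p. p dvd m}"] by simp
    also have "\<dots> \<le> ln (real m)" using m by (intro sum_ln_prime_factors_le) auto
    also have "\<dots> \<le> ln (real y)" using m by simp
    finally show "(\<Sum>p\<in>?P. if p dvd m then ln (real p) else 0) \<le> ln (real y)" .
  qed
  also have "\<dots> = real y * ln (real y)" by simp
  finally have "(real y / 2) * (\<Sum>p\<in>?P. ln (real p) / real p) \<le> real y * ln (real y)"
    by (simp add: sum_distrib_left mult_ac)
  then show ?thesis using assms by (simp add: field_simps)
qed

text \<open>Primes up to \<open>T\<close> are charged 1 each; above \<open>T\<close>,
  \<open>1 / p\<close> is at most \<open>ln p / p\<close> divided by \<open>ln T\<close>. Enlarging
  the free parameter \<open>T\<close> makes the coefficient of \<open>ln y\<close> as small as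
  desired.\<close>

lemma sum_inverse_primes_le:
  fixes y T :: nat
  assumes y: "y \<ge> 1" and T: "T \<ge> 2"
  shows "(\<Sum>p | prime p \<and> p \<le> y. 1 / real p) \<le> real T + 2 * ln (real y) / ln (real T)"
proof -
  let ?P = "{p. prime p \<and> p \<le> y}"
  have lT: "ln (real T) > 0" using T by simp
  have "(\<Sum>p\<in>?P. 1 / real p) \<le> (\<Sum>p\<in>?P. (if p \<in> {1..T} then 1 else 0) + (ln (real p) / real p) / ln (real T))"
  proof (rule sum_mono)
    fix p assume "p \<in> ?P"
    then have p: "p \<ge> 1" using prime_ge_1_nat by auto
    show "1 / real p \<le> (if p \<in> {1..T} then 1 else 0) + (ln (real p) / real p) / ln (real T)"
    proof (cases "p \<le> T")
      case True
      have "1 / real p \<le> 1" using p by simp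
      moreover have "(ln (real p) / real p) / ln (real T) \<ge> 0" using p lT by simp
      ultimately have "1 / real p \<le> 1 + (ln (real p) / real p) / ln (real T)" by linarith
      then show ?thesis using True p by simp
    next
      case False
      then have "ln (real T) \<le> ln (real p)" using T by simp
      then show ?thesis using False p lT by (simp add: field_simps)
    qed
  qed
  also have "\<dots> = real (card (?P \<inter> {1..T})) + (\<Sum>p\<in>?P. ln (real p) / real p) / ln (real T)"
    by (simp add: sum.distrib sum.If_cases sum_divide_distrib Int_def)
  also have "\<dots> \<le> real T + 2 * ln (real y) / ln (real T)"
  proof (intro add_mono divide_right_mono sum_ln_over_primes_le[OF y])
    have "card (?P \<inter> {1..T}) \<le> card {1..T}" by (intro card_mono) auto
    then show "real (card (?P \<inter> {1..T})) \<le> real T" by simp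
  qed (use lT in simp)
  finally show ?thesis .
qed

lemma one_minus_ge_exp:
  fixes x :: real
  assumes "0 \<le> x" "x \<le> 1 / 2"
  shows "1 - x \<ge> exp (- 2 * x)"
proof -
  have "- x - 2 * x\<^sup>2 \<le> ln (1 - x)" by (rule ln_one_minus_pos_lower_bound) (use assms in auto)
  moreover have "2 * x\<^sup>2 \<le> x" using mult_left_mono[OF assms(2,1)] by (simp add: power2_eq_square)
  ultimately have "- 2 * x \<le> ln (1 - x)" by linarith
  then have "exp (- 2 * x) \<le> exp (ln (1 - x))" by simp
  also have "\<dots> = 1 - x" using assms by (intro exp_ln) auto
  finally show ?thesis .
qed

text \<open>Each factor of the Euler product is bounded by \<open>one_minus_ge_exp\<close>. Prime
  factors up to \<open>y\<close> fall under \<open>sum_inverse_primes_le\<close>; those above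
  contribute at most \<open>1 / y\<close> each, and there are at most \<open>ln N / ln 2\<close> of
  them. Later \<open>y\<close> is the dimension, comparable with \<open>ln N\<close>, so that the
  last term stays bounded.\<close>

lemma totient_ge:
  fixes N y T :: nat
  assumes N: "N \<ge> 1" and y: "y \<ge> 1" and T: "T \<ge> 2"
  shows "real (totient N) \<ge>
           real N * exp (- 2 * (real T + 2 * ln (real y) / ln (real T) + ln (real N) / (ln 2 * real y)))"
proof -
  let ?F = "prime_factors N"
  have ge2: "p \<ge> 2" if "p \<in> ?F" for p using that prime_ge_2_nat by auto
  have "(\<Sum>p\<in>?F. ln 2) \<le> (\<Sum>p\<in>?F. ln (real p))"
  proof (rule sum_mono)
    fix p assume "p \<in> ?F"
    then have "p \<ge> 2" by (rule ge2)
    then show "ln 2 \<le> ln (real p)" by simp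
  qed
  also have "\<dots> \<le> ln (real N)" using N by (intro sum_ln_prime_factors_le) auto
  finally have card: "real (card ?F) \<le> ln (real N) / ln 2" by (simp add: field_simps)
  have "(\<Sum>p\<in>?F. 1 / real p) \<le> (\<Sum>p\<in>?F. (if p \<le> y then 1 / real p else 0) + 1 / real y)"
  proof (rule sum_mono)
    fix p
    show "1 / real p \<le> (if p \<le> y then 1 / real p else 0) + 1 / real y"
    proof (cases "p \<le> y")
      case False
      then have "1 / real p \<le> 1 / real y" using y by (intro divide_left_mono) auto
      then show ?thesis using False by simp
    qed simp
  qed
  also have "\<dots> = (\<Sum>p\<in>?F \<inter> {p. p \<le> y}. 1 / real p) + real (card ?F) / real y"
    by (simp add: sum.distrib sum.If_cases)
  also have "(\<Sum>p\<in>?F \<inter> {p. p \<le> y}. 1 / real p) \<le> (\<Sum>p | prime p \<and> p \<le> y. 1 / real p)"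
    by (intro sum_mono2) auto
  also have "\<dots> \<le> real T + 2 * ln (real y) / ln (real T)" using y T by (rule sum_inverse_primes_le)
  also have "real (card ?F) / real y \<le> ln (real N) / ln 2 / real y"
    using card by (intro divide_right_mono) auto
  finally have S: "(\<Sum>p\<in>?F. 1 / real p) \<le> real T + 2 * ln (real y) / ln (real T) + ln (real N) / (ln 2 * real y)"
    by simp
  have "exp (- 2 * (real T + 2 * ln (real y) / ln (real T) + ln (real N) / (ln 2 * real y)))
      \<le> exp (- 2 * (\<Sum>p\<in>?F. 1 / real p))" using S by simp
  also have "\<dots> = (\<Prod>p\<in>?F. exp (- 2 * (1 / real p)))"
    by (simp add: exp_sum sum_distrib_left)
  also have "\<dots> \<le> (\<Prod>p\<in>?F. 1 - 1 / real p)"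
  proof (intro prod_mono conjI)
    fix p assume "p \<in> ?F"
    then have "p \<ge> 2" by (rule ge2)
    then show "exp (- 2 * (1 / real p)) \<le> 1 - 1 / real p" by (intro one_minus_ge_exp) auto
  qed simp
  finally have "exp (- 2 * (real T + 2 * ln (real y) / ln (real T) + ln (real N) / (ln 2 * real y)))
      \<le> (\<Prod>p\<in>?F. 1 - 1 / real p)" .
  then have "real N * exp (- 2 * (real T + 2 * ln (real y) / ln (real T) + ln (real N) / (ln 2 * real y)))
      \<le> real N * (\<Prod>p\<in>?F. 1 - 1 / real p)" by (intro mult_left_mono) auto
  also have "\<dots> = real (totient N)" by (simp add: totient_formula2)
  finally show ?thesis .
qed

subsection \<open>Hermitian spaces over finite fields\<close>

lemma eq_CHAR_power:
  fixes q :: nat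
  assumes q: "primepow q" and card: "card (UNIV :: 'a :: finite_field set) = q\<^sup>2"
  shows "\<exists>k. q = CHAR('a) ^ k"
proof -
  obtain p k where pk: "prime p" "k > 0" "q = p ^ k" using q by (auto simp: primepow_def)
  have "CHAR('a) dvd q\<^sup>2" using CHAR_dvd_CARD[where 'a = 'a] card by simp
  moreover have pC: "prime CHAR('a)" using prime_CHAR_semidom CHAR_pos by blast
  ultimately have "CHAR('a) dvd p" using pk(3) using prime_dvd_power by blast
  then show ?thesis using pk pC primes_dvd_imp_eq by blast
qed

lemma primepow_ge_2: "primepow (q :: nat) \<Longrightarrow> q \<ge> 2"
  using primepow_gt_Suc_0[of q] by simp

lemma card_roots_le:
  fixes p :: "'a :: idom poly"
  assumes "p \<noteq> 0" "degree p \<le> d" "\<And>x. x \<in> S \<Longrightarrow> poly p x = 0"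
  shows "finite S" "card S \<le> d"
proof -
  have sub: "S \<subseteq> {x. poly p x = 0}" using assms(3) by blast
  have fin: "finite {x. poly p x = 0}" using assms(1) by (rule poly_roots_finite)
  show "finite S" using sub fin by (rule finite_subset)
  have "card S \<le> card {x. poly p x = 0}" using fin sub by (rule card_mono)
  also have "\<dots> \<le> degree p" using assms(1) by (rule card_poly_roots_bound)
  finally show "card S \<le> d" using assms(2) by simp
qed

text \<open>The polynomial \<open>X ^ q + X\<close> has too small a degree to vanish on all
  \<open>q\<^sup>2\<close> scalars. This also covers characteristic 2, where \<open>t = 1\<close>
  has trace zero.\<close>

lemma ex_trace_neq_0:
  assumes "q \<ge> 2" and card: "card (UNIV :: 'a :: finite_field set) = q\<^sup>2"
  shows "\<exists>t::'a. t + t ^ q \<noteq> 0"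
proof (rule ccontr)
  assume *: "\<nexists>t::'a. t + t ^ q \<noteq> 0"
  let ?p = "monom 1 q + monom 1 1 :: 'a poly"
  have "coeff ?p q = 1" using assms(1) by simp
  then have "?p \<noteq> 0" by (metis coeff_0 zero_neq_one)
  moreover have "degree ?p \<le> q" using assms(1) by (intro degree_add_le) (auto simp: degree_monom_le intro: order_trans[OF degree_monom_le])
  moreover have "poly ?p x = 0" for x using * by (auto simp: poly_monom add.commute)
  ultimately have "card (UNIV :: 'a set) \<le> q" by (intro card_roots_le(2)[of ?p]) auto
  then show False using card assms(1) by (simp add: power2_eq_square)
qed

text \<open>Pure counting: the norm maps \<open>(q - 1) * (q + 1)\<close> nonzero elements into a
  set of at most \<open>q - 1\<close> elements with fibres of size at most \<open>q + 1\<close>, so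
  every bound is attained.\<close>

lemma norm_surj:
  fixes b :: "'a :: finite_field"
  assumes q: "q \<ge> 2" and card: "CARD('a) = q\<^sup>2" and b: "b \<noteq> 0" "b ^ q = b"
  shows "\<exists>c. c * c ^ q = b"
proof -
  let ?U = "- {0 :: 'a}" and ?R = "{b :: 'a. b \<noteq> 0 \<and> b ^ q = b}" and ?N = "\<lambda>c :: 'a. c * c ^ q"
  have ne: "monom 1 d - [:a:] \<noteq> 0" "degree (monom 1 d - [:a:]) \<le> d" if "d > 0" for a :: 'a and d
  proof -
    have "coeff (monom 1 d - [:a:]) d = 1" using that by (cases d) auto
    then show "monom 1 d - [:a:] \<noteq> 0" by (metis coeff_0 zero_neq_one)
    show "degree (monom 1 d - [:a:]) \<le> d" by (intro degree_diff_le) (auto simp: degree_monom_le)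
  qed
  have "x ^ (q - 1) = 1" if "x \<in> ?R" for x
  proof -
    have "x * x ^ (q - 1) = x * 1" using that q by (simp flip: power_Suc)
    then show ?thesis using that by simp
  qed
  then have R: "card ?R \<le> q - 1"
    using ne[of "q - 1" 1] q by (intro card_roots_le(2)[of "monom 1 (q - 1) - [:1:]"]) (auto simp: poly_monom)
  have "x ^ (q * q) = x" for x :: 'a
    using finite_field_power_card_eq_same[of x] card by (simp add: power2_eq_square)
  then have img: "?N ` ?U \<subseteq> ?R"
    by (auto simp: power_mult_distrib mult.commute simp flip: power_mult)
  have fib: "card {c \<in> ?U. ?N c = y} \<le> q + 1" for y
    using ne[of "q + 1" y] q by (intro card_roots_le(2)[of "monom 1 (q + 1) - [:y:]"]) (auto simp: poly_monom)
  have "?U = (\<Union>y\<in>?N ` ?U. {c \<in> ?U. ?N c = y})" by auto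
  then have "card ?U = card (\<Union>y\<in>?N ` ?U. {c \<in> ?U. ?N c = y})" by (rule arg_cong)
  also have "\<dots> \<le> (\<Sum>y\<in>?N ` ?U. card {c \<in> ?U. ?N c = y})"
    by (rule card_UN_le) simp
  also have "\<dots> \<le> (\<Sum>y\<in>?N ` ?U. q + 1)" by (intro sum_mono fib)
  also have "\<dots> = card (?N ` ?U) * (q + 1)" by simp
  finally have "card ?U \<le> card (?N ` ?U) * (q + 1)" .
  moreover have "card ?U = (q - 1) * (q + 1)"
    using card q by (simp add: card_Diff_singleton Compl_eq_Diff_UNIV power2_eq_square algebra_simps)
  ultimately have "q - 1 \<le> card (?N ` ?U)" using q by (metis Suc_eq_plus1 mult_le_cancel2 zero_less_Suc)
  with R have "?N ` ?U = ?R" by (intro card_subset_eq[OF _ img]) (use card_mono[OF _ img] in auto)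
  then have "b \<in> ?N ` ?U" using b by simp
  then show ?thesis by auto
qed

text \<open>The form lives on a carrier set because neither of the two spaces compared later fills
  its type. Only the first argument is assumed linear; the behaviour in the second follows from
  \<open>h_sym\<close>, since the \<open>q\<close>-th power is additive.\<close>

locale hermitian_space = vector_space scale
  for scale :: "'a :: finite_field \<Rightarrow> 'b :: ab_group_add \<Rightarrow> 'b" +
  fixes q n :: nat and V :: "'b set" and h :: "'b \<Rightarrow> 'b \<Rightarrow> 'a"
  assumes primepow_q: "primepow q"
    and card_scalars: "CARD('a) = q\<^sup>2"
    and subspace_V: "subspace V"
    and card_V: "card V = CARD('a) ^ n"
    and h_add: "\<And>x y z. x \<in> V \<Longrightarrow> y \<in> V \<Longrightarrow> z \<in> V \<Longrightarrow> h (x + y) z = h x z + h y z"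
    and h_scale: "\<And>c x y. x \<in> V \<Longrightarrow> y \<in> V \<Longrightarrow> h (scale c x) y = c * h x y"
    and h_sym: "\<And>x y. x \<in> V \<Longrightarrow> y \<in> V \<Longrightarrow> h y x = h x y ^ q"
    and nondegenerate: "\<And>x. x \<in> V \<Longrightarrow> (\<And>y. y \<in> V \<Longrightarrow> h x y = 0) \<Longrightarrow> x = 0"
begin

lemma q_ge_2: "q \<ge> 2"
  using primepow_q by (rule primepow_ge_2)

lemma q_power_add: "(x + y :: 'a) ^ q = x ^ q + y ^ q"
  using eq_CHAR_power[OF primepow_q card_scalars] freshmans_dream'[where 'a = 'a]
  by (metis prime_CHAR_semidom CHAR_pos)

lemma finite_V: "finite V"
  using card_V by (intro card_ge_0_finite) simp

lemmas V_closed [intro] =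
  subspace_0[OF subspace_V] subspace_add[OF subspace_V] subspace_scale[OF subspace_V] subspace_diff[OF subspace_V]

lemma h_add_right: "x \<in> V \<Longrightarrow> y \<in> V \<Longrightarrow> z \<in> V \<Longrightarrow> h x (y + z) = h x y + h x z"
  using h_sym[of y x] h_sym[of z x] h_sym[of "y + z" x] h_add[of y z x] V_closed by (simp add: q_power_add)

lemma h_scale_right: "x \<in> V \<Longrightarrow> y \<in> V \<Longrightarrow> h x (scale c y) = c ^ q * h x y"
  using h_sym[of y x] h_sym[of "scale c y" x] h_scale[of y x c] V_closed by (simp add: power_mult_distrib)

lemma h_0_left [simp]: "x \<in> V \<Longrightarrow> h 0 x = 0"
  using h_scale[of x x 0] by simp

lemma h_diff: "x \<in> V \<Longrightarrow> y \<in> V \<Longrightarrow> z \<in> V \<Longrightarrow> h (x - y) z = h x z - h y z"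
  using h_add[of "x - y" y z] V_closed by (simp add: algebra_simps)

lemma h_sum:
  "(\<And>i. i \<in> I \<Longrightarrow> f i \<in> V) \<Longrightarrow> z \<in> V \<Longrightarrow> h (\<Sum>i\<in>I. scale (c i) (f i)) z = (\<Sum>i\<in>I. c i * h (f i) z)"
proof (induction I rule: infinite_finite_induct)
  case (insert i I)
  then have "(\<Sum>i\<in>I. scale (c i) (f i)) \<in> V" by (intro subspace_sum[OF subspace_V]) auto
  then show ?case using insert by (simp add: h_add h_scale V_closed)
qed simp_all

section \<open>Orthonormal bases\<close>

definition orthonormal :: "nat \<Rightarrow> (nat \<Rightarrow> 'b) \<Rightarrow> bool" where
  "orthonormal k v \<longleftrightarrow> (\<forall>i<k. v i \<in> V) \<and> (\<forall>i<k. \<forall>j<k. h (v i) (v j) = (if i = j then 1 else 0))"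

text \<open>Pigeonhole: pairing with \<open>k < n\<close> vectors takes at most
  \<open>CARD('a) ^ k\<close> values on \<open>V\<close>, so two vectors share their values, and
  their difference is the witness.\<close>

lemma ex_orthogonal:
  assumes v: "\<And>i. i < k \<Longrightarrow> v i \<in> V" and "k < n"
  shows "\<exists>w\<in>V. w \<noteq> 0 \<and> (\<forall>i<k. h w (v i) = 0)"
proof -
  let ?f = "\<lambda>x. restrict (\<lambda>i. h x (v i)) {..<k}"
  have "?f ` V \<subseteq> {..<k} \<rightarrow>\<^sub>E UNIV" by (intro image_subsetI restrict_PiE) auto
  then have "card (?f ` V) \<le> card ({..<k} \<rightarrow>\<^sub>E (UNIV :: 'a set))"
    by (intro card_mono) (auto intro: finite_PiE)
  also have "\<dots> = CARD('a) ^ k" by (simp add: card_PiE)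
  also have "\<dots> < card V"
  proof -
    have "1 < CARD('a)" using power_strict_mono[of 1 q 2] q_ge_2 unfolding card_scalars by simp
    then show ?thesis unfolding card_V using assms(2) by (rule power_strict_increasing[rotated])
  qed
  finally have "\<not> inj_on ?f V" using card_image by fastforce
  then obtain x y where xy: "x \<in> V" "y \<in> V" "x \<noteq> y" "?f x = ?f y" by (auto simp: inj_on_def)
  have "h (x - y) (v i) = 0" if "i < k" for i
  proof -
    have "h x (v i) = h y (v i)" using fun_cong[OF xy(4), of i] that by simp
    then show ?thesis using xy v[OF that] by (simp add: h_diff)
  qed
  then show ?thesis using xy by (intro bexI[of _ "x - y"]) auto
qed

text \<open>If every vector orthogonal to the \<open>v i\<close> were isotropic, polarization within
  that complement would make \<open>t + t ^ q\<close> vanish for all \<open>t\<close>, contrary to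
  \<open>ex_trace_neq_0\<close>.\<close>

lemma ex_anisotropic:
  assumes v: "orthonormal k v" and "k < n"
  shows "\<exists>w\<in>V. h w w \<noteq> 0 \<and> (\<forall>i<k. h w (v i) = 0)"
proof (rule ccontr)
  assume neg: "\<not> ?thesis"
  have vV: "v i \<in> V" if "i < k" for i using v that by (simp add: orthonormal_def)
  have "\<exists>w\<in>V. w \<noteq> 0 \<and> (\<forall>i<k. h w (v i) = 0)" using vV assms(2) by (rule ex_orthogonal)
  then obtain w where w: "w \<in> V" "w \<noteq> 0" "\<forall>i<k. h w (v i) = 0" by (elim bexE conjE)
  obtain y where y: "y \<in> V" "h w y \<noteq> 0" using nondegenerate[OF w(1)] w(2) by fast
  \<comment> \<open>\<open>s\<close> is the projection of \<open>y\<close> to the span of the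
    \<open>v i\<close>. The difference \<open>z\<close> is orthogonal to the \<open>v i\<close>, and
    since \<open>w\<close> is orthogonal to \<open>s\<close>, it still pairs with \<open>w\<close>
    to a nonzero value.\<close>
  define s where "s = (\<Sum>i<k. scale (h y (v i)) (v i))"
  define z where "z = y - s"
  have s: "s \<in> V" unfolding s_def using vV by (intro subspace_sum[OF subspace_V]) auto
  then have z: "z \<in> V" unfolding z_def using y by blast
  have "h s w = (\<Sum>i<k. h y (v i) * h (v i) w)"
    unfolding s_def using vV w by (intro h_sum) auto
  also have "\<dots> = 0" using w vV h_sym[of w] q_ge_2 by (intro sum.neutral) auto
  finally have "h z w = h y w" unfolding z_def using y s w by (simp add: h_diff)
  then have wz: "h w z \<noteq> 0" using y w z h_sym[of z w] h_sym[of y w] by simp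
  have zv: "h z (v j) = 0" if j: "j < k" for j
  proof -
    have "h s (v j) = (\<Sum>i<k. h y (v i) * h (v i) (v j))"
      unfolding s_def using vV j by (intro h_sum) auto
    also have "\<dots> = (\<Sum>i<k. if i = j then h y (v i) else 0)"
      using v j by (intro sum.cong) (auto simp: orthonormal_def)
    also have "\<dots> = h y (v j)" using j by simp
    finally show ?thesis unfolding z_def using y s vV[OF j] by (simp add: h_diff)
  qed
  have iso: "h x x = 0" if "x \<in> V" "\<And>i. i < k \<Longrightarrow> h x (v i) = 0" for x
    using neg that by blast
  have "t + t ^ q = 0" for t :: 'a
  proof -
    \<comment> \<open>The scaling turns \<open>h ?x z\<close> into the arbitrary \<open>t\<close>;
      as \<open>?x\<close>, \<open>z\<close> and \<open>?x + z\<close> are isotropic, only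
      \<open>t + t ^ q = 0\<close> remains.\<close>
    define c where "c = t / h w z"
    let ?x = "scale c w"
    have x: "?x \<in> V" using w by blast
    have xz: "h ?x z = t" using w z wz by (simp add: h_scale c_def)
    have xv: "h ?x (v i) = 0" if "i < k" for i using w vV[OF that] that by (simp add: h_scale)
    then have 0: "h ?x ?x = 0" "h z z = 0" using x z zv by (auto intro!: iso)
    have "h (?x + z) (?x + z) = 0"
      using x z xv zv vV V_closed by (intro iso) (auto simp: h_add)
    have "h (?x + z) (?x + z) = h ?x ?x + h ?x z + (h z ?x + h z z)"
      using x z by (simp add: h_add h_add_right V_closed)
    then show ?thesis using 0 xz h_sym[OF x z] \<open>h (?x + z) (?x + z) = 0\<close> by simp
  qed
  then show False using ex_trace_neq_0[OF q_ge_2 card_scalars] by blast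
qed

text \<open>An anisotropic vector orthogonal to the earlier ones can be normalized: by symmetry
  \<open>h w w\<close> is fixed under the \<open>q\<close>-th power, so its inverse is a norm
  \<open>c * c ^ q\<close>.\<close>

lemma ex_orthonormal: "k \<le> n \<Longrightarrow> \<exists>v. orthonormal k v"
proof (induction k)
  case 0
  show ?case by (simp add: orthonormal_def)
next
  case (Suc k)
  then obtain v where v: "orthonormal k v" by auto
  obtain w where w: "w \<in> V" "h w w \<noteq> 0" "\<And>i. i < k \<Longrightarrow> h w (v i) = 0"
    using ex_anisotropic[OF v] Suc.prems by auto
  have "(1 / h w w) ^ q = 1 / h w w" using h_sym[OF w(1) w(1)] by (simp add: power_divide)
  then obtain c where c: "c * c ^ q = 1 / h w w"
    using norm_surj[OF q_ge_2 card_scalars, of "1 / h w w"] w by auto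
  let ?x = "scale c w"
  have x: "?x \<in> V" using w by blast
  have 1: "h ?x ?x = 1"
  proof -
    have "h ?x ?x = (c * c ^ q) * h w w" using w x by (simp add: h_scale h_scale_right)
    then show ?thesis unfolding c using w by simp
  qed
  have vV: "v i \<in> V" if "i < k" for i using v that by (simp add: orthonormal_def)
  have 2: "h ?x (v i) = 0" "h (v i) ?x = 0" if "i < k" for i
  proof -
    show *: "h ?x (v i) = 0" using w vV[OF that] that by (simp add: h_scale)
    show "h (v i) ?x = 0" using h_sym[OF x vV[OF that]] * q_ge_2 by simp
  qed
  have "orthonormal (Suc k) (v(k := ?x))"
    unfolding orthonormal_def using v x 1 2 by (auto simp: orthonormal_def less_Suc_eq)
  then show ?case by blast
qed

text \<open>Pairing with \<open>v j\<close> recovers the coefficients, so the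
  \<open>CARD('a) ^ n\<close> linear combinations are distinct and exhaust \<open>V\<close>.\<close>

lemma orthonormal_expand:
  assumes v: "orthonormal n v" and x: "x \<in> V"
  shows "x = (\<Sum>i<n. scale (h x (v i)) (v i))"
proof -
  have vV: "v i \<in> V" if "i < n" for i using v that by (simp add: orthonormal_def)
  let ?C = "{..<n} \<rightarrow>\<^sub>E (UNIV :: 'a set)" and ?g = "\<lambda>c. \<Sum>i<n. scale (c i) (v i)"
  have hg: "h (?g c) (v j) = c j" if j: "j < n" for c j
  proof -
    have "h (?g c) (v j) = (\<Sum>i<n. c i * h (v i) (v j))" using vV j by (intro h_sum) auto
    also have "\<dots> = (\<Sum>i<n. if i = j then c i else 0)"
      using v j by (intro sum.cong) (auto simp: orthonormal_def)
    finally show ?thesis using j by simp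
  qed
  have "inj_on ?g ?C"
  proof (rule inj_onI)
    fix c d assume cd: "c \<in> ?C" "d \<in> ?C" "?g c = ?g d"
    have "c j = d j" if "j < n" for j using hg[OF that, of c] hg[OF that, of d] cd(3) by simp
    then show "c = d" using cd by (intro PiE_ext[of c _ _ d]) auto
  qed
  then have "card (?g ` ?C) = card V" by (simp add: card_image card_V card_PiE)
  moreover have "?g ` ?C \<subseteq> V" using vV by (auto intro!: subspace_sum[OF subspace_V])
  ultimately have "?g ` ?C = V" using finite_V by (simp add: card_subset_eq)
  then obtain c where c: "x = ?g c" using x by blast
  have "(\<Sum>i<n. scale (h x (v i)) (v i)) = ?g c" unfolding c by (intro sum.cong) (auto simp: hg)
  then show ?thesis using c by simp
qed

end

text \<open>Coordinates in one orthonormal basis are carried to the other. Nondegeneracy gives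
  injectivity, and equal cardinality the rest. Through this map the torus is transported to an
  arbitrary given form.\<close>

lemma hermitian_isometry:
  fixes s1 :: "'a :: finite_field \<Rightarrow> 'b :: ab_group_add \<Rightarrow> 'b"
    and s2 :: "'a \<Rightarrow> 'c :: ab_group_add \<Rightarrow> 'c"
  assumes "hermitian_space s1 q n V h" "hermitian_space s2 q n W k"
  shows "\<exists>\<theta>. bij_betw \<theta> V W \<and> (\<forall>x\<in>V. \<forall>y\<in>V. \<theta> (x + y) = \<theta> x + \<theta> y) \<and>
    (\<forall>c. \<forall>x\<in>V. \<theta> (s1 c x) = s2 c (\<theta> x)) \<and> (\<forall>x\<in>V. \<forall>y\<in>V. k (\<theta> x) (\<theta> y) = h x y)"
proof -
  interpret V: hermitian_space s1 q n V h by fact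
  interpret W: hermitian_space s2 q n W k by fact
  obtain v where v: "V.orthonormal n v" using V.ex_orthonormal by blast
  obtain w where w: "W.orthonormal n w" using W.ex_orthonormal by blast
  have vV: "v i \<in> V" if "i < n" for i using v that by (simp add: V.orthonormal_def)
  have wW: "w i \<in> W" if "i < n" for i using w that by (simp add: W.orthonormal_def)
  define \<theta> where "\<theta> x = (\<Sum>i<n. s2 (h x (v i)) (w i))" for x
  have \<theta>W: "\<theta> x \<in> W" for x unfolding \<theta>_def using wW by (auto intro!: W.subspace_sum[OF W.subspace_V])
  have add: "\<theta> (x + y) = \<theta> x + \<theta> y" if "x \<in> V" "y \<in> V" for x y
    unfolding \<theta>_def sum.distrib[symmetric] using that vV
    by (intro sum.cong) (auto simp: V.h_add W.scale_left_distrib)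
  have scale: "\<theta> (s1 c x) = s2 c (\<theta> x)" if "x \<in> V" for c x
    unfolding \<theta>_def W.scale_sum_right using that vV by (intro sum.cong) (auto simp: V.h_scale)
  have \<theta>w: "k (\<theta> x) (w j) = h x (v j)" if "j < n" for x j
  proof -
    have "k (\<theta> x) (w j) = (\<Sum>i<n. h x (v i) * k (w i) (w j))"
      unfolding \<theta>_def using wW that by (intro W.h_sum) auto
    also have "\<dots> = (\<Sum>i<n. if i = j then h x (v i) else 0)"
      using w that by (intro sum.cong) (auto simp: W.orthonormal_def)
    finally show ?thesis using that by simp
  qed
  have iso: "k (\<theta> x) (\<theta> y) = h x y" if "x \<in> V" "y \<in> V" for x y
  proof -
    have "k (\<theta> x) (\<theta> y) = (\<Sum>i<n. h x (v i) * k (w i) (\<theta> y))"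
      unfolding \<theta>_def[of x] using wW \<theta>W by (intro W.h_sum) auto
    also have "\<dots> = (\<Sum>i<n. h x (v i) * h (v i) y)"
      using wW vV \<theta>W that W.h_sym[OF \<theta>W wW] V.h_sym[of y] \<theta>w by (intro sum.cong) auto
    also have "\<dots> = h (\<Sum>i<n. s1 (h x (v i)) (v i)) y" using vV that by (intro V.h_sum[symmetric]) auto
    also have "\<dots> = h x y" using V.orthonormal_expand[OF v that(1)] by simp
    finally show ?thesis .
  qed
  have inj: "inj_on \<theta> V"
  proof (rule inj_onI)
    fix x y assume xy: "x \<in> V" "y \<in> V" "\<theta> x = \<theta> y"
    have "h (x - y) z = 0" if "z \<in> V" for z
      using xy that iso[OF xy(1) that] iso[OF xy(2) that] by (simp add: V.h_diff)
    then have "x - y = 0" using xy by (intro V.nondegenerate) auto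
    then show "x = y" by simp
  qed
  have "\<theta> ` V = W"
    using \<theta>W card_image[OF inj] V.card_V W.card_V W.finite_V by (intro card_subset_eq) auto
  then show ?thesis using inj add scale iso by (auto simp: bij_betw_def intro!: exI[of _ \<theta>])
qed

subsection \<open>Roots of unity in an algebraic closure\<close>

text \<open>The polynomial \<open>X ^ M - X\<close> splits and is separable, its derivative being
  \<open>-1\<close> because the characteristic divides \<open>M\<close>.\<close>

lemma card_frobenius_fixed:
  assumes p: "prime CHAR('k :: alg_closed_field)" and M: "M = CHAR('k) ^ e" "e > 0"
  shows "card {x :: 'k. x ^ M = x} = M"
proof -
  let ?f = "monom 1 M - monom 1 1 :: 'k poly"
  have M2: "M \<ge> 2"
    using prime_ge_2_nat[OF p] M self_le_power[of "CHAR('k)" e] by simp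
  have lc: "coeff ?f M = 1" using M2 by simp
  then have f0: "?f \<noteq> 0" by (metis coeff_0 zero_neq_one)
  have "degree ?f \<le> M" by (intro degree_diff_le) (use M2 in \<open>auto simp: degree_monom_eq\<close>)
  moreover have "M \<le> degree ?f" using lc by (intro le_degree) simp
  ultimately have deg: "degree ?f = M" by simp
  obtain A where A: "size A = M" "?f = smult (lead_coeff ?f) (\<Prod>x\<in>#A. [:-x, 1:])"
    using alg_closed_imp_factorization[OF f0] deg by metis
  have Af: "?f = (\<Prod>x\<in>#A. [:-x, 1:])" using A(2) lc deg by simp
  have "of_nat M = (0 :: 'k)" using M by (simp add: of_nat_eq_0_iff_char_dvd)
  then have der: "pderiv ?f = -1" by (simp add: pderiv_diff pderiv_monom one_pCons monom_0)
  have "count A x \<le> 1" for x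
  proof (rule ccontr)
    assume "\<not> count A x \<le> 1"
    then have "{#x, x#} \<subseteq># A" by (auto simp: subseteq_mset_def)
    then obtain B where "A = {#x, x#} + B" by (metis subset_mset.le_iff_add)
    then have "?f = [:-x, 1:] * ([:-x, 1:] * (\<Prod>x\<in>#B. [:-x, 1:]))" using Af by simp
    then obtain g where "?f = [:-x, 1:] * ([:-x, 1:] * g)" by blast
    then have "pderiv ?f = pderiv ([:-x, 1:] * ([:-x, 1:] * g))" by (rule arg_cong)
    also have "poly \<dots> x = 0" by (simp only: pderiv_mult poly_add poly_mult) simp
    finally have "poly (pderiv ?f) x = 0" .
    then show False unfolding der by simp
  qed
  then have le1: "count A x \<le> 1" for x .
  have "A = mset_set (set_mset A)"
  proof (rule multiset_eqI)
    fix x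
    show "count A x = count (mset_set (set_mset A)) x"
      using le1[of x] by (cases "count A x") (auto simp: not_in_iff count_mset_set' intro: count_inI)
  qed
  then have "card (set_mset A) = M" using A(1) size_mset_set[of "set_mset A"] by simp
  moreover have "poly ?f x = 0 \<longleftrightarrow> x \<in># A" for x
    unfolding Af by (simp add: poly_prod_mset prod_mset_zero_iff image_iff)
  then have "{x. x ^ M = x} = set_mset A" by (auto simp: poly_monom)
  ultimately show ?thesis by simp
qed

lemma frobenius_fixed_diff:
  assumes "prime CHAR('k :: field)" and "M = CHAR('k) ^ e" "x ^ M = x" "y ^ M = (y :: 'k)"
  shows "(x - y) ^ M = x - y"
proof -
  have "(x - y + y) ^ M = (x - y) ^ M + y ^ M" using assms(1,2) by (rule freshmans_dream')
  then show ?thesis using assms by (simp add: algebra_simps)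
qed

text \<open>The field with \<open>M\<close> elements has a multiplicative generator \<open>a\<close>
  of order \<open>M - 1 = N * r\<close>, so \<open>a ^ r\<close> has order \<open>N\<close>.\<close>

lemma ex_mult_order:
  assumes p: "prime CHAR('k :: alg_closed_field)" and M: "M = CHAR('k) ^ e" "e > 0"
    and N: "M - 1 = N * r"
  shows "\<exists>u :: 'k. \<forall>k. u ^ k = 1 \<longleftrightarrow> N dvd k"
proof -
  let ?L = "{x :: 'k. x ^ M = x}"
  \<comment> \<open>The set of fixed points is packaged as a ring with carrier, so that cyclicity of
    the unit group of a finite field applies to it.\<close>
  define R :: "'k ring" where
    "R = \<lparr>carrier = ?L, monoid.mult = (*), one = 1, ring.zero = 0, add = (+)\<rparr>"
  have M2: "M \<ge> 2"
    using prime_ge_2_nat[OF p] M self_le_power[of "CHAR('k)" e] by simp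
  have add: "x + y \<in> ?L" if "x \<in> ?L" "y \<in> ?L" for x y
    using that freshmans_dream'[OF p M(1), of x y] by simp
  have uminus: "- x \<in> ?L" if "x \<in> ?L" for x
    using frobenius_fixed_diff[OF p M(1), of 0 x] that M2 by simp
  have neg: "\<exists>y\<in>?L. x + y = 0" if "x \<in> ?L" for x using uminus[OF that] by (intro bexI[of _ "- x"]) auto
  have inv: "inverse x \<in> ?L" if "x \<in> ?L" for x using that by (simp add: power_inverse)
  have mult: "x * y \<in> ?L" if "x \<in> ?L" "y \<in> ?L" for x y using that by (simp add: power_mult_distrib)
  have "field R"
  proof (rule cring.cring_fieldI2)
    show "cring R"
      by (rule cringI[OF abelian_groupI comm_monoidI])
        (use M2 add mult neg in \<open>auto simp: R_def algebra_simps\<close>)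
    show "\<zero>\<^bsub>R\<^esub> \<noteq> \<one>\<^bsub>R\<^esub>" by (simp add: R_def)
    fix a assume "a \<in> carrier R" "a \<noteq> \<zero>\<^bsub>R\<^esub>"
    then show "\<exists>b\<in>carrier R. a \<otimes>\<^bsub>R\<^esub> b = \<one>\<^bsub>R\<^esub>"
      using inv[of a] by (intro bexI[of _ "inverse a"]) (auto simp: R_def)
  qed
  then interpret R: field R .
  have card: "card ?L = M" using p M by (rule card_frobenius_fixed)
  then have fin: "finite ?L" using M2 by (intro card_ge_0_finite) simp
  then obtain a where a: "a \<in> carrier (mult_of R)" "carrier (mult_of R) = {a [^]\<^bsub>R\<^esub> i | i :: nat. i \<in> UNIV}"
    using R.finite_field_mult_group_has_gen by (auto simp: R_def nat_pow_mult_of)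
  have pow: "a [^]\<^bsub>R\<^esub> i = a ^ i" for i :: nat
    by (induction i) (auto simp: R_def)
  have aL: "a \<in> ?L" "a \<noteq> 0" using a(1) by (auto simp: R_def)
  have range: "?L - {0} = range (\<lambda>i. a ^ i)" using a(2) unfolding pow by (auto simp: R_def)
  have cardR: "card (range (\<lambda>i. a ^ i)) = M - 1"
    unfolding range[symmetric] using card M2 by (subst card_Diff_singleton) (auto simp: zero_power)
  have "a ^ M = a" using aL by simp
  then have "a * a ^ (M - 1) = a * 1" using M2 by (simp flip: power_Suc)
  then have aM: "a ^ (M - 1) = 1" using aL by simp
  have mod: "a ^ i = a ^ (i mod k)" if "a ^ k = 1" for i k
  proof -
    have "a ^ i = a ^ (k * (i div k) + i mod k)" by simp
    also have "\<dots> = (a ^ k) ^ (i div k) * a ^ (i mod k)" by (simp only: power_add power_mult)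
    finally show ?thesis using that by simp
  qed
  \<comment> \<open>With \<open>a ^ k = 1\<close> the powers of \<open>a\<close> repeat with period
    \<open>k\<close>, yet they have to run through all \<open>M - 1\<close> nonzero fixed
    points.\<close>
  have small: "M - 1 \<le> k" if "a ^ k = 1" "k > 0" for k
  proof -
    have "range (\<lambda>i. a ^ i) \<subseteq> (\<lambda>i. a ^ i) ` {..<k}"
      using mod[OF that(1)] that(2) by (metis (no_types, lifting) image_subsetI imageI lessThan_iff mod_less_divisor)
    then have "M - 1 \<le> card ((\<lambda>i. a ^ i) ` {..<k})" unfolding cardR[symmetric] by (intro card_mono) auto
    also have "\<dots> \<le> k" using card_image_le[of "{..<k}" "\<lambda>i. a ^ i"] by simp
    finally show ?thesis .
  qed
  have ord: "a ^ k = 1 \<longleftrightarrow> M - 1 dvd k" for k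
  proof
    assume "a ^ k = 1"
    then have "a ^ (k mod (M - 1)) = 1" using mod[OF aM, of k] by simp
    moreover have "k mod (M - 1) < M - 1" using M2 by simp
    ultimately have "k mod (M - 1) = 0" using small[of "k mod (M - 1)"] by linarith
    then show "M - 1 dvd k" by auto
  next
    assume "M - 1 dvd k"
    then show "a ^ k = 1" using aM by (auto simp: power_mult)
  qed
  have "r > 0" using N M2 by (cases r) auto
  then have "(a ^ r) ^ k = 1 \<longleftrightarrow> N dvd k" for k
    using ord[of "r * k"] N by (simp add: mult.commute flip: power_mult)
  then show ?thesis by blast
qed

text \<open>For \<open>i\<close> coprime to \<open>N\<close> the power \<open>u ^ i\<close> again
  has order \<open>N\<close>, and different exponents below \<open>N\<close> give different
  powers.\<close>

lemma totient_le_card_mult_order: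
  assumes u: "\<forall>k. (u :: 'k :: field) ^ k = 1 \<longleftrightarrow> N dvd k" and "N \<ge> 2"
  shows "finite {w :: 'k. \<forall>k. w ^ k = 1 \<longleftrightarrow> N dvd k}"
    and "totient N \<le> card {w :: 'k. \<forall>k. w ^ k = 1 \<longleftrightarrow> N dvd k}"
proof -
  let ?P = "{w :: 'k. \<forall>k. w ^ k = 1 \<longleftrightarrow> N dvd k}"
  let ?f = "monom 1 N - 1 :: 'k poly"
  have "coeff ?f N = 1" using assms(2) by simp
  then have "?f \<noteq> 0" by (metis coeff_0 zero_neq_one)
  then show fin: "finite ?P"
    by (rule card_roots_le(1)[OF _ order_refl]) (auto simp: poly_monom)
  have "u ^ N = 1" using u by simp
  then have u0: "u \<noteq> 0" using assms(2) by (auto simp: power_0_left)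
  have inj: "inj_on (\<lambda>i. u ^ i) {..<N}"
  proof (rule linorder_inj_onI)
    fix i j assume ij: "i < j" "i \<in> {..<N}" "j \<in> {..<N}"
    show "u ^ i \<noteq> u ^ j"
    proof
      assume "u ^ i = u ^ j"
      moreover have "u ^ j = u ^ i * u ^ (j - i)" using ij by (simp flip: power_add)
      ultimately have "u ^ (j - i) = 1" using u0 by simp
      then have "N dvd j - i" using u u0 by simp
      then show False using ij by (auto dest!: dvd_imp_le)
    qed
  qed auto
  \<comment> \<open>Totatives range up to and including \<open>N\<close>, while injectivity is known
    below \<open>N\<close>; for \<open>N \<ge> 2\<close> the endpoint drops out.\<close>
  have "N \<notin> totatives N" using assms(2) by (auto simp: totatives_def)
  then have sub: "totatives N \<subseteq> {..<N}" by (auto simp: totatives_def le_less)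
  have "(\<lambda>i. u ^ i) ` totatives N \<subseteq> ?P"
  proof (intro image_subsetI CollectI allI)
    fix i k assume "i \<in> totatives N"
    then have "coprime N i" by (auto simp: totatives_def coprime_commute)
    then show "(u ^ i) ^ k = 1 \<longleftrightarrow> N dvd k" using u
      by (simp add: coprime_dvd_mult_right_iff flip: power_mult)
  qed
  then have "card ((\<lambda>i. u ^ i) ` totatives N) \<le> card ?P" using fin by (intro card_mono)
  then show "totient N \<le> card ?P"
    using card_image[OF inj_on_subset[OF inj sub]] by (simp add: totient_def)
qed

text \<open>Keeps the conjugates of a generator distinct later. As \<open>q ^ m\<close> is
  \<open>-1\<close> modulo the divisor, for \<open>2 * k > m\<close> it would have to divide
  \<open>q ^ r + 1\<close> with \<open>r = 2 * k - m < m\<close>; in both cases a positive number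
  smaller than the divisor would be divisible by it.\<close>

lemma not_dvd_power_minus_one:
  fixes q :: nat
  assumes "q \<ge> 2" "0 < k" "k < m"
  shows "\<not> (q ^ m + 1) dvd (q ^ (2 * k) - 1)"
proof
  assume d: "(q ^ m + 1) dvd (q ^ (2 * k) - 1)"
  show False
  proof (cases "2 * k \<le> m")
    case True
    then have "q ^ (2 * k) \<le> q ^ m" using assms by (intro power_increasing) auto
    moreover have "q ^ (2 * k) > 1" using assms by (intro one_less_power) auto
    moreover from this have "q ^ m + 1 \<le> q ^ (2 * k) - 1" using d by (intro dvd_imp_le) auto
    ultimately show False by linarith
  next
    case False
    define r where "r = 2 * k - m"
    have "2 * k = m + r" using False by (simp add: r_def)
    then have "q ^ (2 * k) = q ^ m * q ^ r" by (simp add: power_add)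
    then have "q ^ (2 * k) - 1 + (q ^ r + 1) = (q ^ m + 1) * q ^ r"
      using assms by (simp add: algebra_simps)
    then have "(q ^ m + 1) dvd (q ^ r + 1)" using d by (metis dvd_add_right_iff dvd_triv_left)
    then have "q ^ m \<le> q ^ r" by (auto dest!: dvd_imp_le)
    moreover have "q ^ r < q ^ m" using assms by (intro power_strict_increasing) (auto simp: r_def)
    ultimately show False by simp
  qed
qed

subsection \<open>The trace form\<close>

text \<open>The set \<open>D\<close> absorbs the parity of \<open>n\<close>: it is trivial for odd
  \<open>n\<close> and a copy of the ground field for even \<open>n\<close>, so that both cases
  share one development.\<close>

locale torus_model =
  fixes q m n :: nat and D :: "'a :: finite_field alg_closure set"
  assumes primepow_q: "primepow q"
    and card_scalars: "CARD('a) = q\<^sup>2"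
    and odd_m: "odd m"
    and D_cases: "D = {0} \<and> n = m \<or> D = {y. y ^ (q\<^sup>2) = y} \<and> n = m + 1"
begin

definition L :: "'a alg_closure set" where "L = {x. x ^ (q ^ (2 * m)) = x}"

definition V :: "('a alg_closure \<times> 'a alg_closure) set" where "V = L \<times> D"

definition scale :: "'a \<Rightarrow> 'a alg_closure \<times> 'a alg_closure \<Rightarrow> 'a alg_closure \<times> 'a alg_closure" where
  "scale c p = (to_ac c * fst p, to_ac c * snd p)"

text \<open>The trace of \<open>L\<close> over the ground field: the Galois group is generated by
  the \<open>q\<^sup>2\<close>-th power map.\<close>

definition Tr :: "'a alg_closure \<Rightarrow> 'a alg_closure" where "Tr z = (\<Sum>i<m. z ^ (q ^ (2 * i)))"

text \<open>As \<open>m\<close> is odd, \<open>x \<mapsto> x ^ (q ^ m)\<close> restricts to the involution \<open>c \<mapsto> c ^ q\<close> of the ground field.\<close>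

definition form :: "'a alg_closure \<times> 'a alg_closure \<Rightarrow> 'a alg_closure \<times> 'a alg_closure \<Rightarrow> 'a" where
  "form p p' = of_ac (Tr (fst p * fst p' ^ (q ^ m)) + snd p * snd p' ^ q)"

lemma q_ge_2: "q \<ge> 2"
  using primepow_q by (rule primepow_ge_2)

lemma prime_CHAR: "prime CHAR('a alg_closure)"
  using prime_CHAR_semidom[where 'a = 'a] CHAR_pos[where 'a = 'a] by simp

lemma q_power_eq: "\<exists>e. q ^ j = CHAR('a alg_closure) ^ e \<and> (j > 0 \<longrightarrow> e > 0)"
proof -
  obtain k where k: "q = CHAR('a) ^ k" using eq_CHAR_power[OF primepow_q card_scalars] by blast
  have "k > 0" using k q_ge_2 by (cases k) auto
  then show ?thesis using k by (intro exI[of _ "k * j"]) (simp add: power_mult)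
qed

lemma frob_add: "(x + y :: 'a alg_closure) ^ (q ^ j) = x ^ (q ^ j) + y ^ (q ^ j)"
  using q_power_eq[of j] freshmans_dream'[OF prime_CHAR] by blast

lemma frob_sum: "(sum f A :: 'a alg_closure) ^ (q ^ j) = (\<Sum>i\<in>A. f i ^ (q ^ j))"
  using q_power_eq[of j] freshmans_dream_sum'[OF prime_CHAR] by blast

lemma frob_frob: "((x :: 'a alg_closure) ^ (q ^ i)) ^ (q ^ j) = x ^ (q ^ (i + j))"
  by (simp add: power_add flip: power_mult)

lemma frob_diff: "(x - y :: 'a alg_closure) ^ (q ^ j) = x ^ (q ^ j) - y ^ (q ^ j)"
  using frob_add[of "x - y" y j] by (simp add: algebra_simps)

lemma frob_to_ac [simp]: "to_ac (c :: 'a) ^ (q ^ (2 * j)) = to_ac c"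
  using finite_field_power_card_power_eq_same[of _ j c] card_scalars
  by (simp add: power_mult flip: to_ac_power)

lemma card_L: "card L = CARD('a) ^ m"
proof -
  obtain e where "q ^ (2 * m) = CHAR('a alg_closure) ^ e" "e > 0"
    using q_power_eq[of "2 * m"] odd_m odd_pos by auto
  then have "card L = q ^ (2 * m)" unfolding L_def using prime_CHAR card_frobenius_fixed by blast
  then show ?thesis using card_scalars by (simp add: power_mult)
qed

lemma finite_L: "finite L"
  using card_L by (intro card_ge_0_finite) simp

text \<open>The inclusion is an equality because both sides have \<open>q\<^sup>2\<close> elements.
  Membership in the ground field thus becomes an equation that Frobenius maps can verify.\<close>

lemma range_to_ac: "range to_ac = {y :: 'a alg_closure. y ^ (q\<^sup>2) = y}"
proof -
  obtain e where e: "q ^ 2 = CHAR('a alg_closure) ^ e" "e > 0" using q_power_eq[of 2] by auto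
  then have card: "card {y :: 'a alg_closure. y ^ (q\<^sup>2) = y} = q\<^sup>2"
    using prime_CHAR card_frobenius_fixed by blast
  then have fin: "finite {y :: 'a alg_closure. y ^ (q\<^sup>2) = y}" using q_ge_2 by (intro card_ge_0_finite) simp
  have sub: "range (to_ac :: 'a \<Rightarrow> _) \<subseteq> {y. y ^ (q\<^sup>2) = y}" using frob_to_ac[of _ 1] by auto
  show ?thesis
  proof (rule card_subset_eq[OF fin sub])
    have "card (range (to_ac :: 'a \<Rightarrow> _)) = CARD('a)" using inj_to_ac by (rule card_image)
    then show "card (range (to_ac :: 'a \<Rightarrow> _)) = card {y :: 'a alg_closure. y ^ (q\<^sup>2) = y}"
      using card card_scalars by simp
  qed
qed

lemma L_0 [simp]: "0 \<in> L"
  using q_ge_2 by (simp add: L_def power_0_left)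

lemma L_1 [simp]: "1 \<in> L"
  by (simp add: L_def)

lemma L_add: "x \<in> L \<Longrightarrow> y \<in> L \<Longrightarrow> x + y \<in> L"
  by (simp add: L_def frob_add)

lemma L_diff: "x \<in> L \<Longrightarrow> y \<in> L \<Longrightarrow> x - y \<in> L"
  by (simp add: L_def frob_diff)

lemma L_mult: "x \<in> L \<Longrightarrow> y \<in> L \<Longrightarrow> x * y \<in> L"
  by (simp add: L_def power_mult_distrib)

lemma L_divide: "x \<in> L \<Longrightarrow> y \<in> L \<Longrightarrow> x / y \<in> L"
  by (simp add: L_def power_divide)

lemma L_to_ac [simp]: "to_ac c \<in> L"
  by (simp add: L_def)

lemma L_power: "x \<in> L \<Longrightarrow> x ^ k \<in> L"
  by (induction k) (auto intro: L_mult)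

lemma L_sum: "(\<And>i. i \<in> I \<Longrightarrow> f i \<in> L) \<Longrightarrow> sum f I \<in> L"
  by (induction I rule: infinite_finite_induct) (auto intro: L_add)

lemma D_subset: "D \<subseteq> range to_ac"
  using D_cases q_ge_2 unfolding range_to_ac by (auto simp: power_0_left)

lemma D_0 [simp]: "0 \<in> D"
  using D_cases q_ge_2 by (auto simp: power_0_left)

lemma D_add: "x \<in> D \<Longrightarrow> y \<in> D \<Longrightarrow> x + y \<in> D"
  using D_cases frob_add[of x y 2] by auto

lemma D_scale: "y \<in> D \<Longrightarrow> to_ac c * y \<in> D"
  using D_cases frob_to_ac[of c 1] by (auto simp: power_mult_distrib)

text \<open>The generator is 0 or 1 according to the two cases for \<open>D\<close>; this lets the
  centralizer count treat both parities at once.\<close>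

lemma D_generated: "\<exists>e\<in>D. \<forall>y\<in>D. \<exists>c. y = to_ac c * e"
proof (cases "D = {0}")
  case False
  then have "D = range to_ac" using D_cases range_to_ac by auto
  moreover have "(1 :: 'a alg_closure) \<in> range to_ac" by (metis rangeI to_ac_1)
  ultimately show ?thesis by (intro bexI[of _ 1]) auto
qed auto

lemma card_V: "card V = CARD('a) ^ n"
proof -
  have "card (range (to_ac :: 'a \<Rightarrow> _)) = CARD('a)" using inj_to_ac by (rule card_image)
  then have "card D * CARD('a) ^ m = CARD('a) ^ n" using D_cases by (auto simp flip: range_to_ac)
  then show ?thesis by (simp add: V_def card_cartesian_product card_L mult.commute)
qed

section \<open>The trace from \<open>L\<close> to the ground field\<close>

lemma Tr_add: "Tr (x + y) = Tr x + Tr y"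
  by (simp add: Tr_def frob_add sum.distrib)

lemma Tr_scale: "Tr (to_ac c * z) = to_ac c * Tr z"
  by (simp add: Tr_def power_mult_distrib sum_distrib_left)

lemma Tr_frob: "Tr z ^ (q ^ j) = Tr (z ^ (q ^ j))"
  by (simp add: Tr_def frob_sum frob_frob add.commute)

text \<open>Raising to the power \<open>q\<^sup>2\<close> shifts the summands cyclically, the last
  one returning to \<open>z\<close> because \<open>z \<in> L\<close>.\<close>

lemma Tr_in_range:
  assumes "z \<in> L"
  shows "Tr z \<in> range to_ac"
proof -
  let ?f = "\<lambda>i. z ^ (q ^ (2 * i))"
  have "Tr z ^ (q\<^sup>2) = (\<Sum>i<m. ?f (Suc i))"
    unfolding Tr_def frob_sum by (intro sum.cong) (auto simp: frob_frob)
  moreover have "?f 0 + (\<Sum>i<m. ?f (Suc i)) = (\<Sum>i<m. ?f i) + ?f m"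
    using sum.lessThan_Suc_shift[of ?f m] by simp
  moreover have "?f m = ?f 0" using assms by (simp add: L_def)
  ultimately show ?thesis unfolding range_to_ac Tr_def by simp
qed

text \<open>The trace is given by a nonzero polynomial of degree at most
  \<open>q ^ (2 * (m - 1))\<close>, which is less than the size of \<open>L\<close>.\<close>

lemma ex_Tr_neq_0: "\<exists>z\<in>L. Tr z \<noteq> 0"
proof (rule ccontr)
  assume neg: "\<not> ?thesis"
  let ?p = "\<Sum>i<m. monom 1 (q ^ (2 * i)) :: 'a alg_closure poly"
  obtain m' where m': "m = Suc m'" using odd_m by (cases m) auto
  have lt: "q ^ (2 * i) < q ^ (2 * m')" if "i < m'" for i
    using that q_ge_2 by (intro power_strict_increasing) auto
  have "coeff ?p (q ^ (2 * m')) = 1"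
    using lt by (simp add: m' coeff_sum sum.neutral less_imp_neq)
  then have p0: "?p \<noteq> 0" by (metis coeff_0 zero_neq_one)
  have deg: "degree ?p \<le> q ^ (2 * m')"
    using q_ge_2 by (intro degree_sum_le) (auto simp: m' degree_monom_eq intro!: power_increasing)
  have "card L \<le> q ^ (2 * m')"
    using neg by (intro card_roots_le(2)[OF p0 deg]) (auto simp: poly_sum poly_monom Tr_def)
  also have "\<dots> < q ^ (2 * m)" using q_ge_2 m' by (intro power_strict_increasing) auto
  finally show False using card_L card_scalars by (simp add: power_mult)
qed

lemma Tr_nondegenerate:
  assumes x: "x \<in> L" and 0: "\<And>y. y \<in> L \<Longrightarrow> Tr (y * x) = 0"
  shows "x = 0"
proof (rule ccontr)
  assume "x \<noteq> 0"
  obtain z where "z \<in> L" "Tr z \<noteq> 0" using ex_Tr_neq_0 by blast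
  then show False using 0[of "z / x"] x \<open>x \<noteq> 0\<close> by (simp add: L_divide)
qed

lemma to_ac_form:
  assumes "p \<in> V" "p' \<in> V"
  shows "to_ac (form p p') = Tr (fst p * fst p' ^ (q ^ m)) + snd p * snd p' ^ q"
proof -
  have "fst p * fst p' ^ (q ^ m) \<in> L" using assms by (auto simp: V_def L_mult L_power)
  then obtain c where c: "Tr (fst p * fst p' ^ (q ^ m)) = to_ac c" using Tr_in_range by blast
  have "snd p \<in> range to_ac" "snd p' \<in> range to_ac" using assms D_subset by (auto simp: V_def)
  then obtain d d' where "snd p = to_ac d" "snd p' = to_ac d'" by blast
  then have "Tr (fst p * fst p' ^ (q ^ m)) + snd p * snd p' ^ q = to_ac (c + d * d' ^ q)" by (simp add: c)
  then show ?thesis unfolding form_def by (metis of_ac_to_ac)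
qed

lemma frob_m_to_ac: "to_ac (c :: 'a) ^ (q ^ m) = to_ac c ^ q"
proof -
  obtain k where "m = 2 * k + 1" using odd_m by (elim oddE)
  then have "to_ac c ^ (q ^ m) = (to_ac c ^ (q ^ (2 * k))) ^ q" by (simp add: mult.commute flip: power_mult)
  then show ?thesis by simp
qed

lemma frob_m_frob_m: "x \<in> L \<Longrightarrow> (x ^ (q ^ m)) ^ (q ^ m) = x"
  by (simp add: frob_frob L_def mult_2)

text \<open>Identities between scalars are checked after the injective embedding
  \<open>to_ac\<close>, where \<open>to_ac_form\<close> gives the value of the form without
  \<open>of_ac\<close>.\<close>

sublocale hermitian_space scale q n V form
proof
  fix a b :: 'a and x y :: "'a alg_closure \<times> 'a alg_closure"
  show "scale a (x + y) = scale a x + scale a y" "scale (a + b) x = scale a x + scale b x"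
    "scale a (scale b x) = scale (a * b) x" "scale 1 x = x"
    by (simp_all add: scale_def algebra_simps)
next
  show "Modules.module.subspace scale V"
  proof (subst Modules.module.subspace_def)
    show "Modules.module scale" by unfold_locales (simp_all add: scale_def algebra_simps)
    show "0 \<in> V \<and> (\<forall>x\<in>V. \<forall>y\<in>V. x + y \<in> V) \<and> (\<forall>c. \<forall>x\<in>V. scale c x \<in> V)"
      by (auto simp: V_def scale_def zero_prod_def L_add L_mult D_add D_scale)
  qed
next
  show "card V = CARD('a) ^ n" by (rule card_V)
next
  fix x y z assume "x \<in> V" "y \<in> V" "z \<in> V"
  moreover from this have "x + y \<in> V" by (auto simp: V_def L_add D_add)
  ultimately have "to_ac (form (x + y) z) = to_ac (form x z + form y z)"
    by (simp add: to_ac_form algebra_simps Tr_add)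
  then show "form (x + y) z = form x z + form y z" by (simp only: to_ac_eq_iff)
next
  fix c x y assume "x \<in> V" "y \<in> V"
  moreover from this have "scale c x \<in> V" by (auto simp: V_def scale_def L_mult D_scale)
  ultimately have "to_ac (form (scale c x) y) = to_ac (c * form x y)"
    by (simp add: to_ac_form scale_def algebra_simps Tr_scale)
  then show "form (scale c x) y = c * form x y" by (simp only: to_ac_eq_iff)
next
  fix x y assume xy: "x \<in> V" "y \<in> V"
  then have L: "fst x \<in> L" "fst y \<in> L" by (auto simp: V_def)
  then obtain c where c: "Tr (fst x * fst y ^ (q ^ m)) = to_ac c"
    using Tr_in_range L_mult L_power by blast
  have "snd y \<in> range to_ac" using xy D_subset by (auto simp: V_def)
  then obtain d where d: "snd y = to_ac d" by blast
  have "to_ac (form x y ^ q) = Tr (fst x * fst y ^ (q ^ m)) ^ q + (snd x * snd y ^ q) ^ q"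
    using xy frob_add[of _ _ 1] by (simp add: to_ac_form)
  \<comment> \<open>The trace lies in the ground field, where the powers \<open>q\<close> and
    \<open>q ^ m\<close> agree; the latter is an involution of \<open>L\<close> and exchanges the
    two arguments.\<close>
  also have "Tr (fst x * fst y ^ (q ^ m)) ^ q = Tr (fst y * fst x ^ (q ^ m))"
  proof -
    have "Tr (fst x * fst y ^ (q ^ m)) ^ q = Tr (fst x * fst y ^ (q ^ m)) ^ (q ^ m)"
      by (simp add: c frob_m_to_ac)
    also have "\<dots> = Tr (fst y * fst x ^ (q ^ m))"
      unfolding Tr_frob power_mult_distrib frob_m_frob_m[OF L(2)] by (simp add: mult.commute)
    finally show ?thesis .
  qed
  also have "(snd x * snd y ^ q) ^ q = snd y * snd x ^ q"
    using frob_to_ac[of d 1] by (simp add: d power_mult_distrib power2_eq_square mult.commute flip: power_mult)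
  finally have "to_ac (form x y ^ q) = to_ac (form y x)" using xy by (simp add: to_ac_form)
  then show "form y x = form x y ^ q" by (simp only: to_ac_eq_iff)
next
  fix x assume x: "x \<in> V" and 0: "\<And>y. y \<in> V \<Longrightarrow> form x y = 0"
  \<comment> \<open>Testing against \<open>(y ^ (q ^ m), 0)\<close> yields the plain trace pairing
    with \<open>y\<close>, since the involution undoes the power.\<close>
  have tr: "Tr (y * fst x) = 0" if y: "y \<in> L" for y
  proof -
    have v: "(y ^ (q ^ m), 0) \<in> V" using y by (simp add: V_def L_power)
    then have "to_ac (form x (y ^ (q ^ m), 0)) = 0" using 0 by simp
    then show ?thesis using v x y q_ge_2 by (simp add: to_ac_form frob_m_frob_m mult.commute power_0_left)
  qed
  have "fst x \<in> L" using x by (auto simp: V_def)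
  then have 1: "fst x = 0" by (rule Tr_nondegenerate) (rule tr)
  have v: "(0, snd x) \<in> V" using x by (auto simp: V_def)
  then have "to_ac (form x (0, snd x)) = 0" using 0 by simp
  then have "snd x = 0" using v x 1 q_ge_2 by (simp add: to_ac_form Tr_def power_0_left)
  then show "x = 0" using 1 by (simp add: prod_eq_iff)
qed (use primepow_q card_scalars in auto)

end

subsection \<open>Operators intertwining elements of the torus\<close>

lemma power_power_commute: "(x ^ i) ^ j = (x ^ j) ^ i" for x :: "'b :: monoid_mult"
  by (simp add: mult.commute flip: power_mult)

context torus_model
begin

definition primitive :: "'a alg_closure set" where
  "primitive = {u. \<forall>k. u ^ k = 1 \<longleftrightarrow> q ^ m + 1 dvd k}"

text \<open>The torus is the identity on the extra summand; as generators differ from 1, their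
  action separates \<open>L\<close> from \<open>D\<close>.\<close>

definition act :: "'a alg_closure \<Rightarrow> 'a alg_closure \<times> 'a alg_closure \<Rightarrow> 'a alg_closure \<times> 'a alg_closure" where
  "act u p = (u * fst p, snd p)"

definition isometry :: "('a alg_closure \<times> 'a alg_closure \<Rightarrow> 'a alg_closure \<times> 'a alg_closure) \<Rightarrow> bool" where
  "isometry f \<longleftrightarrow> (\<forall>x\<in>V. f x \<in> V) \<and> (\<forall>x\<in>V. \<forall>y\<in>V. f (x + y) = f x + f y) \<and>
    (\<forall>c. \<forall>x\<in>V. f (scale c x) = scale c (f x)) \<and> (\<forall>x\<in>V. \<forall>y\<in>V. form (f x) (f y) = form x y)"

text \<open>One notion for both counts: conjugacy of two torus elements, and with
  \<open>u = u'\<close> the centralizer of one.\<close>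

definition intertwines where
  "intertwines u u' f \<longleftrightarrow> isometry f \<and> (\<forall>p\<in>V. f (act u p) = act u' (f p))"

lemma q_power_double: "q ^ (2 * k) = q ^ k * q ^ k"
  by (simp add: mult_2 power_add)

lemma m_pos: "m > 0"
  using odd_m odd_pos by blast

lemma finite_primitive: "finite primitive"
  and totient_le_card_primitive: "totient (q ^ m + 1) \<le> card primitive"
proof -
  obtain e where e: "q ^ (2 * m) = CHAR('a alg_closure) ^ e" "e > 0"
    using q_power_eq[of "2 * m"] m_pos by auto
  have "q ^ (2 * m) - 1 = (q ^ m + 1) * (q ^ m - 1)"
    unfolding q_power_double by (simp add: algebra_simps)
  with ex_mult_order[OF prime_CHAR e] obtain u :: "'a alg_closure"
    where u: "\<forall>k. u ^ k = 1 \<longleftrightarrow> q ^ m + 1 dvd k" by blast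
  have 2: "q ^ m + 1 \<ge> 2" using q_ge_2 by (simp add: Suc_le_eq)
  show "finite primitive" "totient (q ^ m + 1) \<le> card primitive"
    unfolding primitive_def using totient_le_card_mult_order[OF u 2] by blast+
qed

lemma primitive_power: "u \<in> primitive \<Longrightarrow> u ^ (q ^ m + 1) = 1"
  unfolding primitive_def mem_Collect_eq by (drule spec[of _ "q ^ m + 1"]) simp

lemma primitive_neq_0: "u \<in> primitive \<Longrightarrow> u \<noteq> 0"
  using primitive_power[of u] by auto

lemma primitive_neq_1: "u \<in> primitive \<Longrightarrow> u \<noteq> 1"
  using q_ge_2 m_pos unfolding primitive_def by (auto dest!: spec[of _ 1])

lemma unit_in_L:
  assumes "u ^ (q ^ m + 1) = 1"
  shows "u \<in> L"
proof -
  have "(q ^ m + 1) * (q ^ m - 1) + 1 = q ^ (2 * m)"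
    using q_ge_2 unfolding q_power_double by (simp add: algebra_simps)
  then have "u ^ (q ^ (2 * m)) = (u ^ (q ^ m + 1)) ^ (q ^ m - 1) * u"
    by (metis power_add power_mult power_one_right)
  then show ?thesis using assms by (simp add: L_def)
qed

lemma primitive_in_L: "u \<in> primitive \<Longrightarrow> u \<in> L"
  by (intro unit_in_L primitive_power)

lemma isometry_act:
  assumes "u ^ (q ^ m + 1) = 1"
  shows "isometry (act u)"
proof -
  have u: "u \<in> L" using assms by (rule unit_in_L)
  have V: "act u p \<in> V" if "p \<in> V" for p using that u by (auto simp: V_def act_def L_mult)
  have "form (act u p) (act u p') = form p p'" for p p'
  proof -
    have "u * u ^ (q ^ m) = 1" using assms by simp
    moreover have "u * x * (u * y) ^ (q ^ m) = u * u ^ (q ^ m) * (x * y ^ (q ^ m))" for x y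
      by (simp add: power_mult_distrib mult_ac)
    ultimately have "u * x * (u * y) ^ (q ^ m) = x * y ^ (q ^ m)" for x y by (simp only: mult_1)
    then show ?thesis unfolding form_def act_def fst_conv snd_conv by (simp only:)
  qed
  then show ?thesis using V by (auto simp: isometry_def act_def scale_def algebra_simps)
qed

section \<open>Powers of a generator as a basis of \<open>L\<close>\<close>

lemma frob_poly_root:
  assumes "(\<Sum>i<k. to_ac (d i :: 'a) * u ^ i) = 0"
  shows "(\<Sum>i<k. to_ac (d i) * (u ^ (q ^ (2 * j))) ^ i) = 0"
proof -
  have "(\<Sum>i<k. to_ac (d i) * u ^ i) ^ (q ^ (2 * j)) = (\<Sum>i<k. to_ac (d i) * (u ^ (q ^ (2 * j))) ^ i)"
    unfolding frob_sum by (intro sum.cong) (simp_all add: power_mult_distrib power_power_commute[of u])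
  then show ?thesis using assms q_ge_2 by (simp add: power_0_left)
qed

text \<open>Two equal conjugates would make \<open>q ^ m + 1\<close> divide
  \<open>q ^ (2 * i) * (q ^ (2 * (j - i)) - 1)\<close>. The first factor is coprime to it, and the
  second is excluded by \<open>not_dvd_power_minus_one\<close>.\<close>

lemma conjugates_inj:
  assumes u: "u \<in> primitive"
  shows "inj_on (\<lambda>j. u ^ (q ^ (2 * j))) {..<m}"
proof (rule linorder_inj_onI)
  fix i j assume ij: "i < j" "i \<in> {..<m}" "j \<in> {..<m}"
  let ?N = "q ^ m + 1"
  have le: "q ^ (2 * i) \<le> q ^ (2 * j)" using ij q_ge_2 by (intro power_increasing) auto
  show "u ^ (q ^ (2 * i)) \<noteq> u ^ (q ^ (2 * j))"
  proof
    assume eq: "u ^ (q ^ (2 * i)) = u ^ (q ^ (2 * j))"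
    have "u ^ (q ^ (2 * j)) = u ^ (q ^ (2 * i)) * u ^ (q ^ (2 * j) - q ^ (2 * i))"
      using le by (simp flip: power_add)
    then have "u ^ (q ^ (2 * j) - q ^ (2 * i)) = 1" using eq primitive_neq_0[OF u] by simp
    then have "?N dvd q ^ (2 * j) - q ^ (2 * i)" using u by (simp add: primitive_def)
    moreover have "2 * j = 2 * i + 2 * (j - i)" using ij by simp
    then have "q ^ (2 * j) = q ^ (2 * i) * q ^ (2 * (j - i))" by (metis power_add)
    then have "q ^ (2 * j) - q ^ (2 * i) = q ^ (2 * i) * (q ^ (2 * (j - i)) - 1)"
      by (simp only: diff_mult_distrib2 mult_1_right)
    ultimately have "?N dvd q ^ (2 * i) * (q ^ (2 * (j - i)) - 1)" by simp
    moreover have "coprime ?N (q ^ (2 * i))"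
    proof -
      have "coprime (q ^ m + 1) (q ^ m)" using coprime_Suc_left_nat[of "q ^ m"] by (simp only: Suc_eq_plus1)
      then have "coprime (q ^ m + 1) q" using m_pos by simp
      then show ?thesis by simp
    qed
    ultimately have "?N dvd q ^ (2 * (j - i)) - 1" by (simp only: coprime_dvd_mult_right_iff)
    moreover have "0 < j - i" "j - i < m" using ij by auto
    ultimately show False using not_dvd_power_minus_one[OF q_ge_2] by blast
  qed
qed auto

text \<open>A nontrivial relation is a nonzero polynomial of degree below \<open>m\<close> over the
  ground field, but it would vanish at all \<open>m\<close> conjugates of \<open>u\<close>.\<close>

lemma powers_independent:
  assumes u: "u \<in> primitive" and 0: "(\<Sum>i<m. to_ac (d i :: 'a) * u ^ i) = 0" and "i < m"
  shows "d i = 0"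
proof (rule ccontr)
  assume di: "d i \<noteq> 0"
  let ?p = "\<Sum>i<m. monom (to_ac (d i)) i"
  have coeff: "coeff ?p j = (if j < m then to_ac (d j) else 0)" for j
    by (simp add: coeff_sum)
  have p0: "?p \<noteq> 0" using coeff[of i] di assms(3) by (metis coeff_0 to_ac_eq_0_iff)
  have deg: "degree ?p \<le> m - 1" using m_pos by (intro degree_le) (auto simp: coeff)
  have "poly ?p (u ^ (q ^ (2 * j))) = 0" for j
    using frob_poly_root[OF 0, of j] by (simp add: poly_sum poly_monom)
  then have "card ((\<lambda>j. u ^ (q ^ (2 * j))) ` {..<m}) \<le> m - 1"
    by (intro card_roots_le(2)[OF p0 deg]) auto
  then show False using card_image[OF conjugates_inj[OF u]] m_pos by simp
qed

lemma powers_span: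
  assumes u: "u \<in> primitive" and x: "x \<in> L"
  shows "\<exists>c. x = (\<Sum>i<m. to_ac (c i) * u ^ i)"
proof -
  let ?C = "{..<m} \<rightarrow>\<^sub>E (UNIV :: 'a set)" and ?g = "\<lambda>c. \<Sum>i<m. to_ac (c i) * u ^ i"
  have "inj_on ?g ?C"
  proof (rule inj_onI)
    fix c d assume cd: "c \<in> ?C" "d \<in> ?C" "?g c = ?g d"
    have "(\<Sum>i<m. to_ac (c i - d i) * u ^ i) = 0"
      using cd(3) by (simp add: left_diff_distrib sum_subtractf)
    then have "c i - d i = 0" if "i < m" for i by (rule powers_independent[OF u _ that])
    then show "c = d" using cd by (intro PiE_ext[of c _ _ d]) auto
  qed
  then have "card (?g ` ?C) = card L" by (simp add: card_image card_L card_PiE)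
  moreover have "?g ` ?C \<subseteq> L"
    by (intro image_subsetI L_sum L_mult L_power L_to_ac primitive_in_L[OF u])
  ultimately have "?g ` ?C = L" using finite_L by (simp add: card_subset_eq)
  then show ?thesis using x by blast
qed

text \<open>The first component of \<open>f (0, y)\<close> is fixed under multiplication by
  \<open>u' \<noteq> 1\<close>. Dually, \<open>(x, 0)\<close> is \<open>act u p - p\<close> for some
  \<open>p\<close>, so its image is \<open>act u' (f p) - f p\<close>, which has no second
  component.\<close>

lemma intertwines_split:
  assumes f: "intertwines u u' f" and u: "u \<in> primitive" "u' \<in> primitive"
  shows "x \<in> L \<Longrightarrow> snd (f (x, 0)) = 0" and "y \<in> D \<Longrightarrow> fst (f (0, y)) = 0"
proof -
  have com: "f (act u p) = act u' (f p)" if "p \<in> V" for p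
    using f that by (simp add: intertwines_def)
  show "fst (f (0, y)) = 0" if y: "y \<in> D"
  proof -
    have "(0, y) \<in> V" using y by (simp add: V_def)
    then have "fst (f (0, y)) = u' * fst (f (0, y))" using com[of "(0, y)"] by (simp add: act_def prod_eq_iff)
    then have "(u' - 1) * fst (f (0, y)) = 0" by (simp add: algebra_simps)
    then show ?thesis using primitive_neq_1[OF u(2)] by simp
  qed
  show "snd (f (x, 0)) = 0" if x: "x \<in> L"
  proof -
    define z where "z = x / (u - 1)"
    have u1: "u - 1 \<noteq> 0" using primitive_neq_1[OF u(1)] by simp
    have z: "z \<in> L" unfolding z_def using x primitive_in_L[OF u(1)] by (intro L_divide L_diff L_1)
    have zV: "(z, 0) \<in> V" "(u * z, 0) \<in> V" "(x, 0) \<in> V"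
      using x z primitive_in_L[OF u(1)] by (auto simp: V_def L_mult)
    have "u * z = x + z" using u1 by (simp add: z_def field_simps)
    then have "f (u * z, 0) = f (x, 0) + f (z, 0)"
      using f zV unfolding intertwines_def isometry_def by (metis add_Pair add.right_neutral)
    moreover have "snd (f (u * z, 0)) = snd (f (z, 0))"
      using com[OF zV(1)] by (simp add: act_def)
    ultimately show ?thesis by simp
  qed
qed

text \<open>Multiplication by \<open>u\<close> turns into multiplication by \<open>u'\<close>, so
  the value at \<open>(1, 0)\<close> governs \<open>f\<close> on all polynomials in \<open>u\<close>
  with ground field coefficients.\<close>

lemma intertwines_poly:
  assumes f: "intertwines u u' f" and u: "u \<in> primitive" "u' \<in> primitive"
  shows "f (\<Sum>i<k. to_ac (c i) * u ^ i, 0) = ((\<Sum>i<k. to_ac (c i) * u' ^ i) * fst (f (1, 0)), 0)"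
proof -
  have com: "f (act u p) = act u' (f p)" if "p \<in> V" for p
    using f that by (simp add: intertwines_def)
  have uL: "u ^ i \<in> L" for i using primitive_in_L[OF u(1)] by (rule L_power)
  have pow: "f (u ^ i, 0) = (u' ^ i * fst (f (1, 0)), 0)" for i
  proof (induction i)
    case 0
    show ?case using intertwines_split(1)[OF f u L_1] by (simp add: prod_eq_iff)
  next
    case (Suc i)
    have "(u ^ i, 0) \<in> V" using uL by (simp add: V_def)
    then show ?case using com[of "(u ^ i, 0)"] Suc by (simp add: act_def mult.assoc)
  qed
  have scale: "f (to_ac c * u ^ i, 0) = (to_ac c * u' ^ i * fst (f (1, 0)), 0)" for c i
  proof -
    have "(u ^ i, 0) \<in> V" using uL by (simp add: V_def)
    then have "f (scale c (u ^ i, 0)) = scale c (f (u ^ i, 0))" using f by (simp add: intertwines_def isometry_def)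
    then show ?thesis by (simp add: pow scale_def mult.assoc)
  qed
  have add: "f (x + y, 0) = f (x, 0) + f (y, 0)" if "x \<in> L" "y \<in> L" for x y
  proof -
    have "(x, 0) \<in> V" "(y, 0) \<in> V" using that by (simp_all add: V_def)
    then have "f ((x, 0) + (y, 0)) = f (x, 0) + f (y, 0)"
      using f unfolding intertwines_def isometry_def by blast
    then show ?thesis by simp
  qed
  show ?thesis
  proof (induction k)
    case 0
    show ?case using scale[of 0 0] by simp
  next
    case (Suc k)
    have "(\<Sum>i<k. to_ac (c i) * u ^ i) \<in> L" "to_ac (c k) * u ^ k \<in> L"
      by (intro L_sum L_mult L_to_ac uL)+
    then show ?case using Suc scale by (simp add: add algebra_simps)
  qed
qed

text \<open>Expressing \<open>u ^ m\<close> by lower powers gives a monic equation of degree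
  \<open>m\<close> over the ground field. An intertwining isometry carries this relation over to
  \<open>u'\<close>, which is therefore a root of the same polynomial.\<close>

lemma card_intertwined_le:
  assumes u: "u \<in> primitive"
  shows "card {u' \<in> primitive. \<exists>f. intertwines u u' f} \<le> m"
proof -
  obtain c where c: "u ^ m = (\<Sum>i<m. to_ac (c i) * u ^ i)"
    using powers_span[OF u L_power[OF primitive_in_L[OF u]]] by blast
  let ?p = "monom 1 m - (\<Sum>i<m. monom (to_ac (c i)) i)"
  have coeff: "coeff ?p j = (if j = m then 1 else if j < m then - to_ac (c j) else 0)" for j
    by (simp add: coeff_sum)
  have p0: "?p \<noteq> 0" using coeff[of m] by (metis coeff_0 zero_neq_one)
  have deg: "degree ?p \<le> m" by (intro degree_le allI impI) (simp only: coeff, simp)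
  show ?thesis
  proof (rule card_roots_le(2)[OF p0 deg])
    fix u' assume "u' \<in> {u' \<in> primitive. \<exists>f. intertwines u u' f}"
    then obtain f where u': "u' \<in> primitive" and f: "intertwines u u' f" by blast
    have V: "(1, 0) \<in> V" "0 \<in> V" by (auto simp: V_def zero_prod_def)
    let ?a = "fst (f (1, 0))"
    let ?d = "\<lambda>i. if i = m then 1 else - c i"
    have "(\<Sum>i<Suc m. to_ac (?d i) * u ^ i) = 0"
      by (simp add: c sum_negf)
    then have "f (0, 0) = ((\<Sum>i<Suc m. to_ac (?d i) * u' ^ i) * ?a, 0)"
      using intertwines_poly[OF f u u', of ?d "Suc m"] by simp
    moreover have "f (scale 0 (1, 0)) = scale 0 (f (1, 0))"
      using f V unfolding intertwines_def isometry_def by blast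
    then have "f (0, 0) = 0" by (simp flip: zero_prod_def)
    \<comment> \<open>Otherwise \<open>f\<close> would kill \<open>(1, 0)\<close>, and preservation
      of the form would put this vector into the radical.\<close>
    moreover have "?a \<noteq> 0"
    proof
      assume "?a = 0"
      then have f0: "f (1, 0) = 0"
        using intertwines_split(1)[OF f u u' L_1] by (simp add: prod_eq_iff)
      have "form (1, 0) y = 0" if y: "y \<in> V" for y
      proof -
        have "form (1, 0) y = form (f (1, 0)) (f y)" "f y \<in> V"
          using f V y unfolding intertwines_def isometry_def by auto
        then show ?thesis using f0 by simp
      qed
      then have "(1, 0) = (0 :: 'a alg_closure \<times> 'a alg_closure)" using V by (intro nondegenerate)
      then show False by (simp add: zero_prod_def)
    qed
    ultimately have "(\<Sum>i<Suc m. to_ac (?d i) * u' ^ i) = 0" by (simp add: zero_prod_def)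
    then show "poly ?p u' = 0" by (simp add: poly_sum poly_monom sum_negf)
  qed
qed

lemma intertwines_self:
  assumes f: "intertwines u u f" and u: "u \<in> primitive" and x: "x \<in> L"
  shows "f (x, 0) = (x * fst (f (1, 0)), 0)"
  using powers_span[OF u x] intertwines_poly[OF f u u, of _ m] by auto

text \<open>On \<open>L\<close> the map is multiplication by \<open>a\<close>, so
  \<open>Tr (x * a ^ (q ^ m + 1)) = Tr x\<close> for all \<open>x\<close>, and the trace pairing is
  nondegenerate.\<close>

lemma intertwines_self_unit:
  assumes f: "intertwines u u f" and u: "u \<in> primitive"
  shows "fst (f (1, 0)) ^ (q ^ m + 1) = 1"
proof -
  define a where "a = fst (f (1, 0))"
  have V: "(x, 0) \<in> V" if "x \<in> L" for x using that by (simp add: V_def)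
  have iso: "form (f p) (f p') = form p p'" "f p \<in> V" if "p \<in> V" "p' \<in> V" for p p'
    using f that by (simp_all add: intertwines_def isometry_def)
  have aL: "a \<in> L" using iso(2)[OF V V, OF L_1 L_1] by (auto simp: a_def V_def)
  have "a ^ (q ^ m + 1) - 1 = 0"
  proof (rule Tr_nondegenerate)
    show "a ^ (q ^ m + 1) - 1 \<in> L" by (intro L_diff L_power aL L_1)
    fix x assume x: "x \<in> L"
    have fx: "f (x, 0) = (x * a, 0)" "f (1, 0) = (a, 0)"
      using intertwines_self[OF f u x] intertwines_self[OF f u L_1] unfolding a_def mult_1 .
    have "to_ac (form (x * a, 0) (a, 0)) = to_ac (form (x, 0) (1, 0))"
      using iso(1)[OF V[OF x] V[OF L_1]] unfolding fx by (rule arg_cong)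
    then have "Tr (x * a * a ^ (q ^ m)) = Tr x"
      unfolding to_ac_form[OF V[OF L_mult[OF x aL]] V[OF aL]] to_ac_form[OF V[OF x] V[OF L_1]] by simp
    moreover have "Tr (x * (a ^ (q ^ m + 1) - 1) + x) = Tr (x * (a ^ (q ^ m + 1) - 1)) + Tr x"
      by (rule Tr_add)
    ultimately show "Tr (x * (a ^ (q ^ m + 1) - 1)) = 0" by (simp add: algebra_simps)
  qed
  then show ?thesis by (simp add: a_def)
qed

text \<open>A commuting isometry is determined by its factor on \<open>L\<close>, a root of
  \<open>X ^ (q ^ m + 1) - 1\<close>, and by the image of a generator of \<open>D\<close>, for which
  the crude bound \<open>q\<^sup>2\<close> costs only a constant factor. \<open>C\<close> and
  \<open>F\<close> are abstract so that matrices can be inserted later.\<close>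

lemma card_centralizer_le:
  assumes u: "u \<in> primitive" and F: "\<And>c. c \<in> C \<Longrightarrow> intertwines u u (F c)"
    and inj: "\<And>c c'. c \<in> C \<Longrightarrow> c' \<in> C \<Longrightarrow> (\<And>p. p \<in> V \<Longrightarrow> F c p = F c' p) \<Longrightarrow> c = c'"
  shows "card C \<le> (q ^ m + 1) * q\<^sup>2"
proof -
  obtain e where e: "e \<in> D" "\<And>y. y \<in> D \<Longrightarrow> \<exists>c. y = to_ac c * e" using D_generated by blast
  let ?N = "q ^ m + 1"
  let ?U = "{a :: 'a alg_closure. a ^ ?N = 1}" and ?K = "range (to_ac :: 'a \<Rightarrow> 'a alg_closure)"
  have "coeff (monom 1 ?N - 1 :: 'a alg_closure poly) ?N = 1" by simp
  then have p0: "monom 1 ?N - 1 \<noteq> (0 :: 'a alg_closure poly)" by (metis coeff_0 zero_neq_one)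
  have deg: "degree (monom 1 ?N - 1 :: 'a alg_closure poly) \<le> ?N"
    by (intro degree_diff_le) (auto simp: degree_monom_le)
  have U: "finite ?U" "card ?U \<le> ?N"
    using card_roots_le[OF p0 deg, of ?U] by (simp_all add: poly_monom)
  have "card ?K = CARD('a)" using inj_to_ac by (rule card_image)
  then have K: "card ?K = q\<^sup>2" using card_scalars by simp
  let ?g = "\<lambda>c. (fst (F c (1, 0)), snd (F c (0, e)))"
  have V: "(x, 0) \<in> V" "(0, y) \<in> V" if "x \<in> L" "y \<in> D" for x y using that by (simp_all add: V_def)
  have "inj_on ?g C"
  proof (rule inj_onI)
    fix c c' assume c: "c \<in> C" "c' \<in> C" "?g c = ?g c'"
    show "c = c'"
    proof (rule inj[OF c(1,2)])
      fix p assume "p \<in> V"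
      then obtain x y where p: "p = (x, y)" "x \<in> L" "y \<in> D" by (auto simp: V_def)
      obtain a where a: "y = to_ac a * e" using e(2) p by blast
      have *: "F d p = (x * fst (F d (1, 0)), to_ac a * snd (F d (0, e)))" if d: "d \<in> C" for d
      proof -
        have iso: "isometry (F d)" using F[OF d] by (simp add: intertwines_def)
        have "F d ((x, 0) + (0, y)) = F d (x, 0) + F d (0, y)"
          using iso V[OF p(2,3)] unfolding isometry_def by blast
        then have "F d p = F d (x, 0) + F d (0, y)" using p by simp
        also have "F d (x, 0) = (x * fst (F d (1, 0)), 0)" using F[OF d] u p(2) by (rule intertwines_self)
        also have "F d (0, y) = F d (scale a (0, e))" by (simp add: a scale_def)
        also have "\<dots> = scale a (F d (0, e))" using iso V[OF L_0 e(1)] unfolding isometry_def by blast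
        also have "\<dots> = (0, to_ac a * snd (F d (0, e)))"
          using intertwines_split(2)[OF F[OF d] u u e(1)] by (simp add: scale_def)
        finally show ?thesis by simp
      qed
      show "F c p = F c' p" using *[OF c(1)] *[OF c(2)] c(3) by simp
    qed
  qed
  moreover have "?g ` C \<subseteq> ?U \<times> ?K"
  proof (rule image_subsetI)
    fix c assume c: "c \<in> C"
    have "F c (0, e) \<in> V" using F[OF c] V[OF L_0 e(1)] unfolding intertwines_def isometry_def by blast
    then have "snd (F c (0, e)) \<in> ?K" using D_subset by (auto simp: V_def)
    then show "?g c \<in> ?U \<times> ?K" using intertwines_self_unit[OF F[OF c] u] by simp
  qed
  ultimately have "card C \<le> card (?U \<times> ?K)" using U(1) by (intro card_inj_on_le) auto
  also have "\<dots> \<le> ?N * q\<^sup>2" unfolding card_cartesian_product K using U(2) by (rule mult_right_mono) simp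
  finally show ?thesis .
qed

end

subsection \<open>Orders in finite groups\<close>

lemma (in group) pow_conj:
  assumes "a \<in> carrier G" "x \<in> carrier G"
  shows "(a \<otimes> x \<otimes> inv a) [^] (k :: nat) = a \<otimes> x [^] k \<otimes> inv a"
proof (induction k)
  case (Suc k)
  have "(a \<otimes> x \<otimes> inv a) [^] Suc k = a \<otimes> x [^] k \<otimes> (inv a \<otimes> a) \<otimes> (x \<otimes> inv a)"
    using assms Suc by (simp only: nat_pow_Suc m_assoc m_closed inv_closed nat_pow_closed)
  then show ?case using assms by (simp add: m_assoc)
qed (use assms in simp)

text \<open>Pairs \<open>(a, u)\<close> are mapped to the conjugate of \<open>s u\<close> by
  \<open>a\<close>. A fibre involves at most \<open>k\<close> values of \<open>u\<close>, each with
  at most \<open>c\<close> values of \<open>a\<close>, so there are at least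
  \<open>card (carrier G) * card I / (c * k)\<close> conjugates, all of order at least
  \<open>N\<close>.\<close>

lemma (in group) sum_ord_ge:
  assumes fin: "finite (carrier G)" and finI: "finite I"
    and s: "\<And>u. u \<in> I \<Longrightarrow> s u \<in> carrier G"
    and cent: "\<And>u. u \<in> I \<Longrightarrow> card {a \<in> carrier G. a \<otimes> s u = s u \<otimes> a} \<le> c"
    and conj: "\<And>u. u \<in> I \<Longrightarrow> card {u' \<in> I. \<exists>a\<in>carrier G. a \<otimes> s u = s u' \<otimes> a} \<le> k"
    and ord: "\<And>u j. u \<in> I \<Longrightarrow> s u [^] (j :: nat) = \<one> \<Longrightarrow> j > 0 \<Longrightarrow> N \<le> j"
  shows "card (carrier G) * card I * N \<le> c * k * (\<Sum>g\<in>carrier G. ord g)"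
proof -
  define \<Phi> where "\<Phi> = (\<lambda>(a, u). a \<otimes> s u \<otimes> inv a)"
  let ?GI = "carrier G \<times> I"
  define R where "R = \<Phi> ` ?GI"
  have RG: "R \<subseteq> carrier G" using s by (auto simp: R_def \<Phi>_def)
  have finR: "finite R" using RG fin by (rule finite_subset)
  have same: "card {a \<in> carrier G. \<Phi> (a, u) = x} \<le> c" if u: "u \<in> I" for u x
  proof (cases "\<exists>b\<in>carrier G. \<Phi> (b, u) = x")
    case True
    then obtain b where b: "b \<in> carrier G" "b \<otimes> s u \<otimes> inv b = x" by (auto simp: \<Phi>_def)
    have "card {a \<in> carrier G. \<Phi> (a, u) = x} \<le> card {a \<in> carrier G. a \<otimes> s u = s u \<otimes> a}"
    proof (rule card_inj_on_le)
      \<comment> \<open>Translation by the inverse of one solution \<open>b\<close> moves all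
        solutions into the centralizer of \<open>s u\<close>.\<close>
      show "inj_on (\<lambda>a. inv b \<otimes> a) {a \<in> carrier G. \<Phi> (a, u) = x}"
        using b by (auto simp: inj_on_def)
      show "finite {a \<in> carrier G. a \<otimes> s u = s u \<otimes> a}" using fin by simp
      show "(\<lambda>a. inv b \<otimes> a) ` {a \<in> carrier G. \<Phi> (a, u) = x} \<subseteq> {a \<in> carrier G. a \<otimes> s u = s u \<otimes> a}"
      proof (rule image_subsetI)
        fix a assume "a \<in> {a \<in> carrier G. \<Phi> (a, u) = x}"
        then have a: "a \<in> carrier G" "a \<otimes> s u \<otimes> inv a = b \<otimes> s u \<otimes> inv b"
          using b by (auto simp: \<Phi>_def)
        note su = s[OF u]
        have "inv b \<otimes> a \<otimes> s u = inv b \<otimes> (a \<otimes> s u \<otimes> inv a) \<otimes> a"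
          using a(1) b(1) su by (simp add: m_assoc)
        also have "\<dots> = (inv b \<otimes> b) \<otimes> s u \<otimes> (inv b \<otimes> a)"
          unfolding a(2) using a(1) b(1) su by (simp only: m_assoc m_closed inv_closed)
        also have "\<dots> = s u \<otimes> (inv b \<otimes> a)" using a(1) b(1) su by simp
        finally show "inv b \<otimes> a \<in> {a \<in> carrier G. a \<otimes> s u = s u \<otimes> a}" using a(1) b(1) by simp
      qed
    qed
    also have "\<dots> \<le> c" using u by (rule cent)
    finally show ?thesis .
  next
    case False
    then have "{a \<in> carrier G. \<Phi> (a, u) = x} = {}" by blast
    then show ?thesis by (simp only: card.empty)
  qed
  have fibre: "card {p \<in> ?GI. \<Phi> p = x} \<le> c * k" if x: "x \<in> R" for x
  proof -
    obtain b v where b: "b \<in> carrier G" "v \<in> I" "b \<otimes> s v \<otimes> inv b = x"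
      using x by (auto simp: R_def \<Phi>_def)
    \<comment> \<open>Every \<open>u\<close> occurring in the fibre of \<open>x\<close> is conjugate
      to the fixed \<open>v\<close>, which the hypothesis \<open>conj\<close> limits to
      \<open>k\<close> choices.\<close>
    let ?J = "{u' \<in> I. \<exists>a\<in>carrier G. a \<otimes> s v = s u' \<otimes> a}"
    have "{p \<in> ?GI. \<Phi> p = x} \<subseteq> (\<Union>u\<in>?J. (\<lambda>a. (a, u)) ` {a \<in> carrier G. \<Phi> (a, u) = x})"
    proof
      fix p assume "p \<in> {p \<in> ?GI. \<Phi> p = x}"
      then obtain a u where p: "p = (a, u)" "a \<in> carrier G" "u \<in> I" "\<Phi> (a, u) = x" by auto
      then have eq: "a \<otimes> s u \<otimes> inv a = b \<otimes> s v \<otimes> inv b" using b by (simp add: \<Phi>_def)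
      note su = s[OF p(3)] and sv = s[OF b(2)]
      have "inv a \<otimes> b \<otimes> s v = inv a \<otimes> (b \<otimes> s v \<otimes> inv b) \<otimes> b"
        using p(2) b(1) sv by (simp add: m_assoc)
      also have "\<dots> = (inv a \<otimes> a) \<otimes> s u \<otimes> (inv a \<otimes> b)"
        unfolding eq[symmetric] using p(2) b(1) su by (simp only: m_assoc m_closed inv_closed)
      also have "\<dots> = s u \<otimes> (inv a \<otimes> b)" using p(2) b(1) su by simp
      finally have "u \<in> ?J" using p b by blast
      then show "p \<in> (\<Union>u\<in>?J. (\<lambda>a. (a, u)) ` {a \<in> carrier G. \<Phi> (a, u) = x})" using p by blast
    qed
    then have "card {p \<in> ?GI. \<Phi> p = x} \<le> card (\<Union>u\<in>?J. (\<lambda>a. (a, u)) ` {a \<in> carrier G. \<Phi> (a, u) = x})"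
      using fin finI by (intro card_mono) auto
    also have "\<dots> \<le> (\<Sum>u\<in>?J. card ((\<lambda>a. (a, u)) ` {a \<in> carrier G. \<Phi> (a, u) = x}))"
      using finI by (intro card_UN_le) simp
    also have "\<dots> \<le> (\<Sum>u\<in>?J. c)"
    proof (rule sum_mono)
      fix u assume "u \<in> ?J"
      then have "u \<in> I" by blast
      have "card ((\<lambda>a. (a, u)) ` {a \<in> carrier G. \<Phi> (a, u) = x}) \<le> card {a \<in> carrier G. \<Phi> (a, u) = x}"
        using fin by (intro card_image_le) simp
      also have "\<dots> \<le> c" using \<open>u \<in> I\<close> by (rule same)
      finally show "card ((\<lambda>a. (a, u)) ` {a \<in> carrier G. \<Phi> (a, u) = x}) \<le> c" .
    qed
    also have "\<dots> = card ?J * c" by simp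
    also have "\<dots> \<le> k * c" using conj[OF b(2)] by (rule mult_right_mono) simp
    finally show ?thesis by (simp only: mult.commute)
  qed
  have ordR: "N \<le> ord x" if x: "x \<in> R" for x
  proof -
    obtain b v where b: "b \<in> carrier G" "v \<in> I" "x = b \<otimes> s v \<otimes> inv b"
      using x by (auto simp: R_def \<Phi>_def)
    note sv = s[OF b(2)]
    have xG: "x \<in> carrier G" using x RG by blast
    have "b \<otimes> s v [^] ord x \<otimes> inv b = \<one>"
      using pow_ord_eq_1[OF xG] pow_conj[OF b(1) sv] b(3) by simp
    then have "b \<otimes> s v [^] ord x = b" using b(1) sv by (metis inv_closed inv_equality inv_inv m_closed nat_pow_closed)
    then have "s v [^] ord x = \<one>" using b(1) sv by (simp add: r_cancel_one)
    moreover have "ord x > 0" using ord_ge_1[OF fin xG] by simp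
    ultimately show ?thesis by (rule ord[OF b(2)])
  qed
  have "?GI = (\<Union>x\<in>R. {p \<in> ?GI. \<Phi> p = x})" by (auto simp: R_def)
  then have "card ?GI = card (\<Union>x\<in>R. {p \<in> ?GI. \<Phi> p = x})" by (rule arg_cong)
  also have "\<dots> \<le> (\<Sum>x\<in>R. card {p \<in> ?GI. \<Phi> p = x})" using finR by (rule card_UN_le)
  also have "\<dots> \<le> (\<Sum>x\<in>R. c * k)" by (intro sum_mono fibre)
  also have "\<dots> = c * k * card R" by simp
  finally have "card ?GI * N \<le> c * k * (card R * N)" by (simp add: mult.assoc[symmetric])
  also have "card R * N = (\<Sum>x\<in>R. N)" by simp
  also have "\<dots> \<le> (\<Sum>x\<in>R. ord x)" by (intro sum_mono ordR)
  also have "\<dots> \<le> (\<Sum>x\<in>carrier G. ord x)" using fin RG by (intro sum_mono2) auto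
  finally show ?thesis by (simp add: card_cartesian_product)
qed


subsection \<open>The torus inside the unitary group\<close>

lemma mat_of_linear_map:
  fixes \<phi> :: "'a :: field vec \<Rightarrow> 'a vec"
  assumes closed: "\<And>v. v \<in> carrier_vec n \<Longrightarrow> \<phi> v \<in> carrier_vec n"
    and add: "\<And>v w. v \<in> carrier_vec n \<Longrightarrow> w \<in> carrier_vec n \<Longrightarrow> \<phi> (v + w) = \<phi> v + \<phi> w"
    and scale: "\<And>c v. v \<in> carrier_vec n \<Longrightarrow> \<phi> (c \<cdot>\<^sub>v v) = c \<cdot>\<^sub>v \<phi> v"
    and v: "v \<in> carrier_vec n"
  shows "mat n n (\<lambda>(i, j). \<phi> (unit_vec n j) $ i) *\<^sub>v v = \<phi> v"
proof -
  \<comment> \<open>\<open>?t k\<close> keeps the first \<open>k\<close> coordinates of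
    \<open>v\<close>, so the induction adds one multiple of a unit vector at a time.\<close>
  let ?t = "\<lambda>k. vec n (\<lambda>i. if i < k then v $ i else 0)"
  have step: "\<phi> (?t k) $ i = (\<Sum>j<k. \<phi> (unit_vec n j) $ i * v $ j)" if i: "i < n" and "k \<le> n" for k i
    using that(2)
  proof (induction k)
    case 0
    have "?t 0 = 0 \<cdot>\<^sub>v 0\<^sub>v n" by (intro eq_vecI) auto
    then have "\<phi> (?t 0) = 0 \<cdot>\<^sub>v \<phi> (0\<^sub>v n)" using scale[of "0\<^sub>v n" 0] by simp
    then show ?case using i closed[of "0\<^sub>v n"] by simp
  next
    case (Suc k)
    have "?t (Suc k) = ?t k + v $ k \<cdot>\<^sub>v unit_vec n k"
      using Suc.prems by (intro eq_vecI) (auto simp: less_Suc_eq)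
    then have "\<phi> (?t (Suc k)) = \<phi> (?t k) + v $ k \<cdot>\<^sub>v \<phi> (unit_vec n k)" by (simp add: add scale)
    then show ?case using Suc i closed[of "unit_vec n k"] closed[of "?t k"] by (simp add: mult.commute)
  qed
  have "?t n = v" using v by (intro eq_vecI) auto
  then have "\<phi> v $ i = (\<Sum>j<n. \<phi> (unit_vec n j) $ i * v $ j)" if "i < n" for i
    using step[OF that order_refl] by simp
  then show ?thesis using v closed[OF v]
    by (intro eq_vecI) (auto simp: scalar_prod_def lessThan_atLeast0)
qed

lemma eq_mat_on_vecI:
  fixes A :: "'a :: field mat"
  assumes A: "A \<in> carrier_mat n n" "A' \<in> carrier_mat n n"
    and eq: "\<And>v. v \<in> carrier_vec n \<Longrightarrow> A *\<^sub>v v = A' *\<^sub>v v"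
  shows "A = A'"
proof (rule eq_matI)
  fix i j assume ij: "i < dim_row A'" "j < dim_col A'"
  have "(A *\<^sub>v unit_vec n j) $ i = (A' *\<^sub>v unit_vec n j) $ i" using eq[of "unit_vec n j"] by simp
  then show "A $$ (i, j) = A' $$ (i, j)" using A ij by simp
qed (use A in auto)

text \<open>The type \<open>'a vec\<close> mixes all lengths, so vectors of length \<open>n\<close>
  are represented by functions vanishing from \<open>n\<close> on, a subspace of a commutative
  group; the form is read through \<open>vec n\<close>.\<close>

lemma hermitian_space_coordinates:
  fixes B :: "'a :: finite_field vec \<Rightarrow> 'a vec \<Rightarrow> 'a"
  assumes q: "primepow q" and card: "CARD('a) = q\<^sup>2" and B: "unitary_form q n B"
  shows "hermitian_space (\<lambda>c f i. c * f i) q n {f. \<forall>i\<ge>n. f i = 0} (\<lambda>f g. B (vec n f) (vec n g))"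
proof
  let ?W = "{f :: nat \<Rightarrow> 'a. \<forall>i\<ge>n. f i = 0}"
  have vec_add: "vec n (f + g) = vec n f + vec n g" for f g :: "nat \<Rightarrow> 'a" by (intro eq_vecI) auto
  have vec_scale: "vec n (\<lambda>i. c * f i) = c \<cdot>\<^sub>v vec n f" for c :: 'a and f by (intro eq_vecI) auto
  have B_add: "B (x + y) z = B x z + B y z"
    if "x \<in> carrier_vec n" "y \<in> carrier_vec n" "z \<in> carrier_vec n" for x y z
    using B that unfolding unitary_form_def sesquilinear_form_def by blast
  have B_scale: "B (c \<cdot>\<^sub>v x) y = c * B x y" if "x \<in> carrier_vec n" "y \<in> carrier_vec n" for c x y
    using B that unfolding unitary_form_def sesquilinear_form_def by blast
  have B_sym: "B y x = B x y ^ q" if "x \<in> carrier_vec n" "y \<in> carrier_vec n" for x y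
    using B that unfolding unitary_form_def by blast
  have B_nondeg: "x = 0\<^sub>v n" if "x \<in> carrier_vec n" "\<forall>y\<in>carrier_vec n. B x y = 0" for x
    using B that unfolding unitary_form_def nondegenerate_form_def by blast
  show "primepow q" "CARD('a) = q\<^sup>2" by fact+
  show "(\<lambda>i. a * (x + y) i) = (\<lambda>i. a * x i) + (\<lambda>i. a * y i)"
    "(\<lambda>i. (a + b) * x i) = (\<lambda>i. a * x i) + (\<lambda>i. b * x i)"
    "(\<lambda>i. a * (b * x i)) = (\<lambda>i. a * b * x i)" "(\<lambda>i. 1 * x i) = x" for a b :: 'a and x y :: "nat \<Rightarrow> 'a"
    by (auto simp: fun_eq_iff algebra_simps)
  then interpret vs: vector_space "\<lambda>(c :: 'a) f (i :: nat). c * f i" by unfold_locales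
  show "vs.subspace ?W" by (auto simp: vs.subspace_def)
  have "bij_betw (\<lambda>f. restrict f {..<n}) ?W ({..<n} \<rightarrow>\<^sub>E UNIV)"
  proof (rule bij_betw_byWitness[where f' = "\<lambda>f i. if i < n then f i else 0"])
    show "\<forall>f\<in>?W. (\<lambda>i. if i < n then restrict f {..<n} i else 0) = f" by (auto simp: fun_eq_iff)
    show "\<forall>f\<in>{..<n} \<rightarrow>\<^sub>E (UNIV :: 'a set). restrict (\<lambda>i. if i < n then f i else 0) {..<n} = f"
      by (auto simp: fun_eq_iff PiE_def extensional_def)
    show "(\<lambda>f. restrict f {..<n}) ` ?W \<subseteq> {..<n} \<rightarrow>\<^sub>E UNIV"
      by (intro image_subsetI) (simp add: PiE_def)
    show "(\<lambda>f i. if i < n then f i else 0) ` ({..<n} \<rightarrow>\<^sub>E UNIV) \<subseteq> ?W"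
      by (intro image_subsetI) simp
  qed
  then have "card ?W = card ({..<n} \<rightarrow>\<^sub>E (UNIV :: 'a set))" by (rule bij_betw_same_card)
  then show "card ?W = CARD('a) ^ n" by (simp add: card_PiE)
  fix x y z :: "nat \<Rightarrow> 'a" and c :: 'a
  show "B (vec n (x + y)) (vec n z) = B (vec n x) (vec n z) + B (vec n y) (vec n z)"
    unfolding vec_add by (intro B_add) auto
  show "B (vec n (\<lambda>i. c * x i)) (vec n y) = c * B (vec n x) (vec n y)"
    unfolding vec_scale by (intro B_scale) auto
  show "B (vec n y) (vec n x) = B (vec n x) (vec n y) ^ q" by (intro B_sym) auto
  assume x: "x \<in> ?W" and 0: "\<And>y. y \<in> ?W \<Longrightarrow> B (vec n x) (vec n y) = 0"
  have "B (vec n x) v = 0" if v: "v \<in> carrier_vec n" for v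
  proof -
    have "vec n (\<lambda>i. if i < n then v $ i else 0) = v" using v by (intro eq_vecI) auto
    then show ?thesis using 0[of "\<lambda>i. if i < n then v $ i else 0"] by simp
  qed
  then have "vec n x = 0\<^sub>v n" by (intro B_nondeg) auto
  then have "x i = 0" if "i < n" for i using that by (metis index_vec index_zero_vec(1))
  then show "x = 0" using x by (auto simp: fun_eq_iff) (metis linorder_not_less)
qed

lemma (in torus_model) ex_coordinates:
  assumes B: "unitary_form q n B"
  shows "\<exists>\<eta>. bij_betw \<eta> V (carrier_vec n) \<and> (\<forall>x\<in>V. \<forall>y\<in>V. \<eta> (x + y) = \<eta> x + \<eta> y) \<and>
    (\<forall>c. \<forall>x\<in>V. \<eta> (scale c x) = c \<cdot>\<^sub>v \<eta> x) \<and> (\<forall>x\<in>V. \<forall>y\<in>V. B (\<eta> x) (\<eta> y) = form x y)"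
proof -
  let ?W = "{f :: nat \<Rightarrow> 'a. \<forall>i\<ge>n. f i = 0}"
  obtain \<theta> where \<theta>: "bij_betw \<theta> V ?W" "\<forall>x\<in>V. \<forall>y\<in>V. \<theta> (x + y) = \<theta> x + \<theta> y"
    "\<forall>c. \<forall>x\<in>V. \<theta> (scale c x) = (\<lambda>i. c * \<theta> x i)"
    "\<forall>x\<in>V. \<forall>y\<in>V. B (vec n (\<theta> x)) (vec n (\<theta> y)) = form x y"
    using hermitian_isometry[OF hermitian_space_axioms hermitian_space_coordinates[OF primepow_q card_scalars B]]
    by (elim exE conjE)
  have "bij_betw (vec n) ?W (carrier_vec n)"
  proof (rule bij_betw_byWitness[where f' = "\<lambda>(v :: 'a vec) i. if i < n then v $ i else 0"])
    show "\<forall>f\<in>?W. (\<lambda>i. if i < n then vec n f $ i else 0) = f" by (auto simp: fun_eq_iff)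
    show "\<forall>v\<in>carrier_vec n. vec n (\<lambda>i. if i < n then v $ i else (0 :: 'a)) = v"
      by (intro ballI eq_vecI) auto
    show "vec n ` ?W \<subseteq> carrier_vec n" by (intro image_subsetI) simp
    show "(\<lambda>(v :: 'a vec) i. if i < n then v $ i else 0) ` carrier_vec n \<subseteq> ?W" by (intro image_subsetI) simp
  qed
  with \<theta>(1) have "bij_betw (vec n \<circ> \<theta>) V (carrier_vec n)" by (rule bij_betw_trans)
  moreover have "vec n (f + g) = vec n f + vec n g" for f g :: "nat \<Rightarrow> 'a" by (intro eq_vecI) auto
  moreover have "vec n (\<lambda>i. c * f i) = c \<cdot>\<^sub>v vec n f" for c :: 'a and f by (intro eq_vecI) auto
  ultimately show ?thesis using \<theta>(2-4) by (intro exI[of _ "vec n \<circ> \<theta>"]) simp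
qed

locale torus_coordinates = torus_model +
  fixes B and \<eta>
  assumes B_form: "unitary_form q n B"
    and bij: "bij_betw \<eta> V (carrier_vec n)"
    and \<eta>_add: "\<And>x y. x \<in> V \<Longrightarrow> y \<in> V \<Longrightarrow> \<eta> (x + y) = \<eta> x + \<eta> y"
    and \<eta>_scale: "\<And>c x. x \<in> V \<Longrightarrow> \<eta> (scale c x) = c \<cdot>\<^sub>v \<eta> x"
    and \<eta>_form: "\<And>x y. x \<in> V \<Longrightarrow> y \<in> V \<Longrightarrow> B (\<eta> x) (\<eta> y) = form x y"
begin

abbreviation U :: "'a mat monoid" where "U \<equiv> unitary_group n B"

abbreviation \<eta>' where "\<eta>' \<equiv> inv_into V \<eta>"

section \<open>Matrices of the torus elements\<close>

definition torus_mat :: "'a alg_closure \<Rightarrow> 'a mat" where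
  "torus_mat u = mat n n (\<lambda>(i, j). \<eta> (act u (\<eta>' (unit_vec n j))) $ i)"

lemma \<eta>_closed: "x \<in> V \<Longrightarrow> \<eta> x \<in> carrier_vec n"
  using bij by (auto simp: bij_betw_def)

lemma \<eta>'_closed: "v \<in> carrier_vec n \<Longrightarrow> \<eta>' v \<in> V"
  using bij by (auto simp: bij_betw_def intro: inv_into_into)

lemma \<eta>_\<eta>' [simp]: "v \<in> carrier_vec n \<Longrightarrow> \<eta> (\<eta>' v) = v"
  using bij by (auto simp: bij_betw_def f_inv_into_f)

lemma \<eta>'_\<eta> [simp]: "x \<in> V \<Longrightarrow> \<eta>' (\<eta> x) = x"
  using bij by (auto simp: bij_betw_def)

lemma \<eta>_inject: "x \<in> V \<Longrightarrow> y \<in> V \<Longrightarrow> \<eta> x = \<eta> y \<longleftrightarrow> x = y"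
  using bij by (auto simp: bij_betw_def inj_on_def)

lemma \<eta>'_add: "v \<in> carrier_vec n \<Longrightarrow> w \<in> carrier_vec n \<Longrightarrow> \<eta>' (v + w) = \<eta>' v + \<eta>' w"
  using \<eta>_add[of "\<eta>' v" "\<eta>' w"] \<eta>'_\<eta>[of "\<eta>' v + \<eta>' w"] by (simp add: \<eta>'_closed V_closed)

lemma \<eta>'_scale: "v \<in> carrier_vec n \<Longrightarrow> \<eta>' (c \<cdot>\<^sub>v v) = scale c (\<eta>' v)"
  using \<eta>_scale[of "\<eta>' v" c] \<eta>'_\<eta>[of "scale c (\<eta>' v)"] by (simp add: \<eta>'_closed V_closed)

lemma torus_mat_mult:
  assumes u: "u ^ (q ^ m + 1) = 1" and x: "x \<in> V"
  shows "torus_mat u *\<^sub>v \<eta> x = \<eta> (act u x)"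
proof -
  have iso: "act u p \<in> V" "act u (p + p') = act u p + act u p'" "act u (scale c p) = scale c (act u p)"
    if "p \<in> V" "p' \<in> V" for p p' c
    using isometry_act[OF u] that unfolding isometry_def by blast+
  have "torus_mat u *\<^sub>v \<eta> x = \<eta> (act u (\<eta>' (\<eta> x)))"
    unfolding torus_mat_def
    by (rule mat_of_linear_map[where \<phi> = "\<lambda>v. \<eta> (act u (\<eta>' v))"])
      (use x in \<open>simp_all add: \<eta>_closed \<eta>'_closed \<eta>'_add \<eta>'_scale iso \<eta>_add \<eta>_scale\<close>)
  then show ?thesis using x by simp
qed

lemma torus_mat_carrier [simp]: "torus_mat u \<in> carrier_mat n n"
  by (simp add: torus_mat_def)

lemma mem_U_iff:
  "A \<in> carrier U \<longleftrightarrow> A \<in> carrier (GL n) \<and>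
    (\<forall>x\<in>carrier_vec n. \<forall>y\<in>carrier_vec n. B (A *\<^sub>v x) (A *\<^sub>v y) = B x y)"
  by (simp add: unitary_group_def)

lemma U_mat: "A \<in> carrier U \<Longrightarrow> A \<in> carrier_mat n n"
  using GL_simps(3) mem_U_iff by blast

lemma U_mult [simp]: "monoid.mult U = (*)" and U_one [simp]: "one U = 1\<^sub>m n"
  by (simp_all add: unitary_group_def GL_simps)

lemma group_U: "group U"
proof -
  interpret G: group "GL n :: 'a mat monoid" by (rule group_GL)
  have "group ((GL n)\<lparr>carrier := carrier U\<rparr>)"
    by (rule subgroup.subgroup_is_group[OF subgroup_unitary_group group_GL])
  moreover have "(GL n)\<lparr>carrier := carrier U\<rparr> = U" by (simp add: unitary_group_def)
  ultimately show ?thesis by simp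
qed

lemma torus_mat_times:
  assumes "u ^ (q ^ m + 1) = 1" "v ^ (q ^ m + 1) = 1"
  shows "torus_mat u * torus_mat v = torus_mat (u * v)"
proof (rule eq_mat_on_vecI)
  fix w :: "'a vec" assume w: "w \<in> carrier_vec n"
  define x where "x = \<eta>' w"
  have x: "x \<in> V" "w = \<eta> x" using w by (simp_all add: x_def \<eta>'_closed)
  have vx: "act v x \<in> V" using isometry_act[OF assms(2)] x(1) unfolding isometry_def by blast
  have "(u * v) ^ (q ^ m + 1) = 1" unfolding power_mult_distrib assms by simp
  then have "torus_mat (u * v) *\<^sub>v w = \<eta> (act u (act v x))"
    using x by (simp only: torus_mat_mult) (simp add: act_def mult.assoc)
  then show "torus_mat u * torus_mat v *\<^sub>v w = torus_mat (u * v) *\<^sub>v w"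
    using w x vx assms by (simp add: assoc_mult_mat_vec[of _ n n _ n] torus_mat_mult del: power_Suc)
qed (simp_all add: mult_carrier_mat[of _ n n])

lemma torus_mat_one: "torus_mat 1 = 1\<^sub>m n"
proof (rule eq_mat_on_vecI)
  fix w :: "'a vec" assume w: "w \<in> carrier_vec n"
  then have "torus_mat 1 *\<^sub>v \<eta> (\<eta>' w) = \<eta> (act 1 (\<eta>' w))" by (intro torus_mat_mult \<eta>'_closed) simp_all
  then show "torus_mat 1 *\<^sub>v w = 1\<^sub>m n *\<^sub>v w" using w by (simp add: act_def)
qed simp_all

text \<open>Invertibility comes from multiplicativity: \<open>1 / u\<close> satisfies the same
  equation, and its matrix is the inverse.\<close>

lemma torus_mat_in_U:
  assumes u: "u ^ (q ^ m + 1) = 1"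
  shows "torus_mat u \<in> carrier U"
  unfolding mem_U_iff
proof (intro conjI ballI)
  have u0: "u \<noteq> 0" using u by auto
  have u': "(1 / u) ^ (q ^ m + 1) = 1" using u unfolding power_divide by simp
  have "torus_mat u * torus_mat (1 / u) = 1\<^sub>m n" "torus_mat (1 / u) * torus_mat u = 1\<^sub>m n"
    unfolding torus_mat_times[OF u u'] torus_mat_times[OF u' u] using u0 torus_mat_one by simp_all
  then show "torus_mat u \<in> carrier (GL n)"
    by (auto simp: GL_def units_of_def Units_def ring_mat_def intro!: bexI[of _ "torus_mat (1 / u)"])
  fix v w :: "'a vec" assume "v \<in> carrier_vec n" "w \<in> carrier_vec n"
  then obtain x y where xy: "x \<in> V" "v = \<eta> x" "y \<in> V" "w = \<eta> y" using \<eta>'_closed \<eta>_\<eta>' by metis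
  have "act u x \<in> V" "act u y \<in> V" "form (act u x) (act u y) = form x y"
    using isometry_act[OF u] xy unfolding isometry_def by blast+
  then show "B (torus_mat u *\<^sub>v v) (torus_mat u *\<^sub>v w) = B v w"
    unfolding xy(2,4) torus_mat_mult[OF u xy(1)] torus_mat_mult[OF u xy(3)]
    using xy by (simp add: \<eta>_form)
qed

lemma torus_mat_pow:
  assumes u: "u ^ (q ^ m + 1) = 1"
  shows "torus_mat u [^]\<^bsub>U\<^esub> (k :: nat) = torus_mat (u ^ k)"
proof (induction k)
  case (Suc k)
  have "(u ^ k) ^ (q ^ m + 1) = 1" unfolding power_power_commute[of u k] u by simp
  then show ?case using Suc torus_mat_times[OF _ u, of "u ^ k"]
    by (simp add: nat_pow_def mult.commute)
qed (simp add: nat_pow_def torus_mat_one)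

lemma torus_mat_eq_oneD:
  assumes u: "u ^ (q ^ m + 1) = 1" and 1: "torus_mat u = 1\<^sub>m n"
  shows "u = 1"
proof -
  have V: "(1, 0) \<in> V" by (simp add: V_def)
  then have "act u (1, 0) \<in> V" using isometry_act[OF u] unfolding isometry_def by blast
  moreover have "\<eta> (act u (1, 0)) = \<eta> (1, 0)"
    using torus_mat_mult[OF u V] 1 \<eta>_closed[OF V] by simp
  ultimately have "act u (1, 0) = (1, 0)" using V by (simp only: \<eta>_inject)
  then show ?thesis by (simp add: act_def)
qed

text \<open>The return path from matrices to maps of the field model: equations in the unitary group
  become statements about isometries of \<open>V\<close>, where the counting bounds are
  available.\<close>

definition pullback :: "'a mat \<Rightarrow> 'a alg_closure \<times> 'a alg_closure \<Rightarrow> 'a alg_closure \<times> 'a alg_closure" where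
  "pullback A x = \<eta>' (A *\<^sub>v \<eta> x)"

lemma pullback:
  assumes A: "A \<in> carrier U" and x: "x \<in> V"
  shows "pullback A x \<in> V" "\<eta> (pullback A x) = A *\<^sub>v \<eta> x"
proof -
  have "A *\<^sub>v \<eta> x \<in> carrier_vec n" using U_mat[OF A] \<eta>_closed[OF x] by simp
  then show "pullback A x \<in> V" "\<eta> (pullback A x) = A *\<^sub>v \<eta> x" by (simp_all add: pullback_def \<eta>'_closed)
qed

lemma isometry_pullback:
  assumes A: "A \<in> carrier U"
  shows "isometry (pullback A)"
  unfolding isometry_def
proof (intro conjI ballI allI)
  note cA = U_mat[OF A]
  fix x y and c :: 'a assume x: "x \<in> V"
  then show "pullback A x \<in> V" using A by (intro pullback)
  show "pullback A (scale c x) = scale c (pullback A x)"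
    using pullback[OF A x] cA \<eta>_closed[OF x] \<eta>'_scale[of "A *\<^sub>v \<eta> x" c]
    by (simp add: pullback_def \<eta>_scale[OF x] mult_mat_vec[of _ n n])
  assume y: "y \<in> V"
  show "pullback A (x + y) = pullback A x + pullback A y"
    using cA \<eta>_closed[OF x] \<eta>_closed[OF y] \<eta>'_add[of "A *\<^sub>v \<eta> x" "A *\<^sub>v \<eta> y"]
    by (simp add: pullback_def \<eta>_add[OF x y] mult_add_distrib_mat_vec[of _ n n])
  have "form (pullback A x) (pullback A y) = B (A *\<^sub>v \<eta> x) (A *\<^sub>v \<eta> y)"
    using pullback[OF A x] pullback[OF A y] \<eta>_form by metis
  also have "\<dots> = form x y" using A \<eta>_closed[OF x] \<eta>_closed[OF y] \<eta>_form[OF x y] by (simp add: mem_U_iff)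
  finally show "form (pullback A x) (pullback A y) = form x y" .
qed

lemma pullback_inject:
  assumes A: "A \<in> carrier U" "A' \<in> carrier U" and eq: "\<And>x. x \<in> V \<Longrightarrow> pullback A x = pullback A' x"
  shows "A = A'"
proof (rule eq_mat_on_vecI[OF U_mat[OF A(1)] U_mat[OF A(2)]])
  fix v :: "'a vec" assume v: "v \<in> carrier_vec n"
  then show "A *\<^sub>v v = A' *\<^sub>v v"
    using pullback(2)[OF A(1) \<eta>'_closed[OF v]] pullback(2)[OF A(2) \<eta>'_closed[OF v]] eq[OF \<eta>'_closed[OF v]]
    by simp
qed

lemma intertwines_pullback:
  assumes A: "A \<in> carrier U" and u: "u \<in> primitive" "u' \<in> primitive"
    and eq: "A * torus_mat u = torus_mat u' * A"
  shows "intertwines u u' (pullback A)"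
  unfolding intertwines_def
proof (intro conjI ballI)
  show "isometry (pullback A)" using A by (rule isometry_pullback)
  fix x assume x: "x \<in> V"
  note cA = U_mat[OF A] and u1 = primitive_power[OF u(1)] and u2 = primitive_power[OF u(2)]
  have ux: "act u x \<in> V" using isometry_act[OF u1] x unfolding isometry_def by blast
  have "A *\<^sub>v \<eta> (act u x) = A *\<^sub>v (torus_mat u *\<^sub>v \<eta> x)" by (simp only: torus_mat_mult[OF u1 x])
  also have "\<dots> = (A * torus_mat u) *\<^sub>v \<eta> x"
    by (rule assoc_mult_mat_vec[OF cA torus_mat_carrier \<eta>_closed[OF x], symmetric])
  also have "\<dots> = torus_mat u' *\<^sub>v (A *\<^sub>v \<eta> x)"
    unfolding eq by (rule assoc_mult_mat_vec[OF torus_mat_carrier cA \<eta>_closed[OF x]])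
  also have "\<dots> = \<eta> (act u' (pullback A x))"
    using torus_mat_mult[OF u2 pullback(1)[OF A x]] pullback(2)[OF A x] by simp
  finally have "pullback A (act u x) = \<eta>' (\<eta> (act u' (pullback A x)))" by (simp only: pullback_def)
  moreover have "act u' (pullback A x) \<in> V"
    using isometry_act[OF u2] pullback(1)[OF A x] unfolding isometry_def by blast
  ultimately show "pullback A (act u x) = act u' (pullback A x)" by simp
qed

lemma finite_U: "finite (carrier U)"
proof (rule inj_on_finite)
  show "inj_on (\<lambda>A. restrict (pullback A) V) (carrier U)"
  proof (rule inj_onI)
    fix A A' assume A: "A \<in> carrier U" "A' \<in> carrier U"
      and eq: "restrict (pullback A) V = restrict (pullback A') V"
    show "A = A'" using A
    proof (rule pullback_inject)
      fix x assume "x \<in> V"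
      then show "pullback A x = pullback A' x" using fun_cong[OF eq, of x] by simp
    qed
  qed
  show "(\<lambda>A. restrict (pullback A) V) ` carrier U \<subseteq> V \<rightarrow>\<^sub>E V"
    by (intro image_subsetI restrict_PiE_iff[THEN iffD2] ballI pullback)
  show "finite (V \<rightarrow>\<^sub>E V)" using finite_V by (intro finite_PiE)
qed

text \<open>This is \<open>sum_ord_ge\<close> for the matrices of all generators, with centralizer
  bound \<open>?N * q\<^sup>2\<close> and conjugacy bound \<open>m\<close>.\<close>

lemma average_order_ge: "average_order U \<ge> real (totient (q ^ m + 1)) / (real m * (real q)\<^sup>2)"
proof -
  interpret group U by (rule group_U)
  let ?N = "q ^ m + 1" and ?S = "\<Sum>g\<in>carrier U. group.ord U g"
  have in_U: "torus_mat u \<in> carrier U" if "u \<in> primitive" for u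
    using primitive_power[OF that] by (rule torus_mat_in_U)
  have "card (carrier U) * card primitive * ?N \<le> (?N * q\<^sup>2) * m * ?S"
  proof (rule sum_ord_ge[OF finite_U finite_primitive in_U])
    fix u assume u: "u \<in> primitive"
    show "card {A \<in> carrier U. A \<otimes>\<^bsub>U\<^esub> torus_mat u = torus_mat u \<otimes>\<^bsub>U\<^esub> A} \<le> ?N * q\<^sup>2"
      by (rule card_centralizer_le[OF u, where F = pullback])
        (use u in \<open>auto intro: intertwines_pullback pullback_inject\<close>)
    have "{u' \<in> primitive. \<exists>A\<in>carrier U. A \<otimes>\<^bsub>U\<^esub> torus_mat u = torus_mat u' \<otimes>\<^bsub>U\<^esub> A}
        \<subseteq> {u' \<in> primitive. \<exists>f. intertwines u u' f}"
      using u intertwines_pullback by auto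
    then have "card {u' \<in> primitive. \<exists>A\<in>carrier U. A \<otimes>\<^bsub>U\<^esub> torus_mat u = torus_mat u' \<otimes>\<^bsub>U\<^esub> A}
        \<le> card {u' \<in> primitive. \<exists>f. intertwines u u' f}"
      using finite_primitive by (intro card_mono) auto
    then show "card {u' \<in> primitive. \<exists>A\<in>carrier U. A \<otimes>\<^bsub>U\<^esub> torus_mat u = torus_mat u' \<otimes>\<^bsub>U\<^esub> A} \<le> m"
      using card_intertwined_le[OF u] by (rule le_trans)
    fix j :: nat assume j: "torus_mat u [^]\<^bsub>U\<^esub> j = \<one>\<^bsub>U\<^esub>" "j > 0"
    have "(u ^ j) ^ ?N = 1" unfolding power_power_commute[of u j] primitive_power[OF u] by simp
    moreover have "torus_mat (u ^ j) = 1\<^sub>m n" using j(1) torus_mat_pow[OF primitive_power[OF u]] by simp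
    ultimately have "u ^ j = 1" by (rule torus_mat_eq_oneD)
    then have "?N dvd j" using u unfolding primitive_def by blast
    then show "?N \<le> j" using j(2) by (rule dvd_imp_le)
  qed simp
  \<comment> \<open>The order \<open>?N\<close> of the elements cancels against the torus part of
    the centralizer bound.\<close>
  then have "card (carrier U) * card primitive \<le> q\<^sup>2 * m * ?S" by (simp add: mult_ac del: mult_Suc mult_Suc_right)
  moreover have "card (carrier U) * totient ?N \<le> card (carrier U) * card primitive"
    using totient_le_card_primitive by (rule mult_left_mono) simp
  ultimately have "real (card (carrier U) * totient ?N) \<le> real (q\<^sup>2 * m * ?S)"
    by (intro of_nat_mono) (rule le_trans)
  then have "real (card (carrier U)) * real (totient ?N) \<le> (real m * (real q)\<^sup>2) * real ?S"
    by (simp add: mult_ac)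
  moreover have "real (card (carrier U)) > 0" using finite_U one_closed by (auto simp: card_gt_0_iff)
  moreover have "real m * (real q)\<^sup>2 > 0" using m_pos q_ge_2 by simp
  ultimately show ?thesis
    unfolding average_order_def Coset.order_def by (simp add: divide_simps mult_ac)
qed

end

lemma unitary_average_order_ge:
  fixes B :: "'a :: finite_field vec \<Rightarrow> 'a vec \<Rightarrow> 'a"
  assumes "primepow q" "CARD('a) = q\<^sup>2" "unitary_form q n B"
    and m: "odd m" "n = m \<or> n = m + 1"
  shows "average_order (unitary_group n B) \<ge> real (totient (q ^ m + 1)) / (real m * (real q)\<^sup>2)"
proof -
  define D :: "'a alg_closure set" where "D = (if n = m then {0} else {y. y ^ (q\<^sup>2) = y})"
  interpret torus_model q m n D
    using assms by unfold_locales (auto simp: D_def)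
  obtain \<eta> where \<eta>: "bij_betw \<eta> V (carrier_vec n)" "\<forall>x\<in>V. \<forall>y\<in>V. \<eta> (x + y) = \<eta> x + \<eta> y"
    "\<forall>c. \<forall>x\<in>V. \<eta> (scale c x) = c \<cdot>\<^sub>v \<eta> x" "\<forall>x\<in>V. \<forall>y\<in>V. B (\<eta> x) (\<eta> y) = form x y"
    using ex_coordinates[OF assms(3)] by (elim exE conjE)
  interpret torus_coordinates q m n D B \<eta>
    using \<eta> assms(3) by unfold_locales auto
  show ?thesis by (rule average_order_ge)
qed


subsection \<open>Asymptotics\<close>

text \<open>In the error, \<open>3 * ln q\<close> collects the factor \<open>q\<^sup>2\<close> and
  the step from \<open>n\<close> to \<open>m \<ge> n - 1\<close>; the terms with \<open>T\<close>
  and the bounded rest are twice the exponent from \<open>totient_ge\<close>.\<close>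

lemma ln_average_order_ge:
  fixes B :: "'a :: finite_field vec \<Rightarrow> 'a vec \<Rightarrow> 'a" and T :: nat
  assumes q: "primepow q" and card: "CARD('a) = q\<^sup>2" and B: "unitary_form q n B"
    and n: "n \<ge> 1" and T: "T \<ge> 2"
  shows "ln (average_order (unitary_group n B)) \<ge> real n * ln (real q) - ln (real n)
    - (3 * ln (real q) + 2 * real T + 2 * (1 + ln (real q) / ln 2)) - 4 * ln (real n) / ln (real T)"
proof -
  define m where "m = (if odd n then n else n - 1)"
  have m: "odd m" "n = m \<or> n = m + 1" using n by (auto simp: m_def)
  have m1: "m \<ge> 1" using m(1) odd_pos[of m] by simp
  have mn: "m \<le> n" "n \<le> m + 1" using m(2) by auto
  have q2: "q \<ge> 2" using q by (rule primepow_ge_2)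
  \<comment> \<open>The cutoff \<open>y\<close> for the primes is \<open>n\<close> itself: since
    \<open>ln (q ^ m + 1)\<close> is at most \<open>n * (ln 2 + ln q)\<close>, the last summand is
    bounded independently of \<open>n\<close>.\<close>
  define E where "E = real T + 2 * ln (real n) / ln (real T) + ln (real (q ^ m + 1)) / (ln 2 * real n)"
  have "q ^ m + 1 \<le> 2 * q ^ m" using q2 by simp
  also have "\<dots> \<le> 2 * q ^ n" using q2 mn by (intro mult_left_mono power_increasing) auto
  finally have "real (q ^ m + 1) \<le> 2 * real q ^ n"
    by (metis of_nat_le_iff of_nat_mult of_nat_numeral of_nat_power)
  then have "ln (real (q ^ m + 1)) \<le> ln (2 * real q ^ n)" using q2 by (intro ln_mono) (auto intro: add_pos_nonneg)
  also have "\<dots> = ln 2 + real n * ln (real q)" using q2 by (simp add: ln_mult ln_realpow)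
  also have "\<dots> \<le> real n * ln 2 + real n * ln (real q)" using n by simp
  finally have "ln (real (q ^ m + 1)) / (ln 2 * real n) \<le> (real n * ln 2 + real n * ln (real q)) / (ln 2 * real n)"
    by (intro divide_right_mono) auto
  also have "\<dots> = 1 + ln (real q) / ln 2" using n by (simp add: field_simps)
  finally have E: "E \<le> real T + 2 * ln (real n) / ln (real T) + (1 + ln (real q) / ln 2)"
    unfolding E_def by simp
  have "real q ^ m * exp (- 2 * E) / (real n * (real q)\<^sup>2) \<le> real q ^ m * exp (- 2 * E) / (real m * (real q)\<^sup>2)"
    using mn m1 q2 by (intro divide_left_mono mult_right_mono mult_pos_pos) auto
  also have "\<dots> \<le> real (q ^ m + 1) * exp (- 2 * E) / (real m * (real q)\<^sup>2)"
    by (intro divide_right_mono mult_right_mono) auto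
  also have "\<dots> \<le> real (totient (q ^ m + 1)) / (real m * (real q)\<^sup>2)"
    using totient_ge[of "q ^ m + 1" n T] n T unfolding E_def by (intro divide_right_mono) auto
  also have "\<dots> \<le> average_order (unitary_group n B)"
    using q card B m by (rule unitary_average_order_ge)
  finally have avg: "real q ^ m * exp (- 2 * E) / (real n * (real q)\<^sup>2) \<le> average_order (unitary_group n B)" .
  moreover have pos: "0 < real q ^ m * exp (- 2 * E) / (real n * (real q)\<^sup>2)" using q2 n by simp
  ultimately have "ln (real q ^ m * exp (- 2 * E) / (real n * (real q)\<^sup>2)) \<le> ln (average_order (unitary_group n B))"
    by (intro ln_mono) auto
  moreover have "ln (real q ^ m * exp (- 2 * E) / (real n * (real q)\<^sup>2))
      = real m * ln (real q) - 2 * E - (ln (real n) + 2 * ln (real q))"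
    using q2 n by (simp add: ln_div ln_mult ln_realpow)
  moreover have "real n * ln (real q) \<le> (real m + 1) * ln (real q)"
    using mn q2 by (intro mult_right_mono) auto
  then have "real n * ln (real q) \<le> real m * ln (real q) + ln (real q)" by (simp add: distrib_right)
  moreover have "2 * E \<le> 2 * real T + 4 * ln (real n) / ln (real T) + 2 * (1 + ln (real q) / ln 2)"
    using E by simp
  ultimately show ?thesis by linarith
qed

theorem theorem25:
  fixes q :: nat and B :: "nat \<Rightarrow> 'a :: finite_field vec \<Rightarrow> 'a vec \<Rightarrow> 'a"
  assumes "primepow q"
    and "CARD('a) = q\<^sup>2"
    and "\<And>n. n \<ge> 1 \<Longrightarrow> unitary_form q n (B n)"
  shows "\<exists>e :: nat \<Rightarrow> real. e \<in> o(\<lambda>n. ln (real n)) \<and>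
           (\<forall>n\<ge>1. ln (average_order (unitary_group n (B n))) \<ge> real n * ln (real q) - ln (real n) + e n)"
proof -
  define a where "a n = ln (average_order (unitary_group n (B n))) - real n * ln (real q) + ln (real n)" for n
  \<comment> \<open>Cutting the exact error \<open>a n\<close> off at 0 makes the inequality hold
    for every \<open>n\<close> and leaves only a lower bound on \<open>a n\<close> to prove.\<close>
  define e where "e n = min 0 (a n)" for n
  have "e \<in> o(\<lambda>n. ln (real n))"
  proof (rule landau_o.smallI)
    fix c :: real assume c: "c > 0"
    \<comment> \<open>This choice gives \<open>ln T \<ge> 8 / c\<close>, so the term
      \<open>4 * ln n / ln T\<close> uses up half of \<open>c * ln n\<close>. The constant
      \<open>C\<close>, which depends on \<open>c\<close> but not on \<open>n\<close>, is absorbed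
      by the other half for large \<open>n\<close>.\<close>
    define T where "T = nat \<lceil>exp (8 / c)\<rceil> + 2"
    have T: "T \<ge> 2" by (simp add: T_def)
    have "exp (8 / c) \<le> real T" unfolding T_def by linarith
    then have "8 / c \<le> ln (real T)" using T by (simp add: ln_ge_iff)
    then have "4 / ln (real T) \<le> c / 2"
      using c T by (simp add: field_simps)
    then have T': "4 * ln (real n) / ln (real T) \<le> c / 2 * ln (real n)" if "n \<ge> 1" for n
      using mult_right_mono[of "4 / ln (real T)" "c / 2" "ln (real n)"] that by simp
    define C where "C = 3 * ln (real q) + 2 * real T + 2 * (1 + ln (real q) / ln 2)"
    have "filterlim (\<lambda>n. ln (real n)) at_top sequentially"
      by (rule filterlim_compose[OF ln_at_top filterlim_real_sequentially])
    then have "eventually (\<lambda>n. 2 * C / c \<le> ln (real n)) sequentially"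
      by (simp add: filterlim_at_top)
    then show "eventually (\<lambda>n. norm (e n) \<le> c * norm (ln (real n))) sequentially"
      using eventually_ge_at_top[of 1]
    proof eventually_elim
      case (elim n)
      have "ln (average_order (unitary_group n (B n))) \<ge> real n * ln (real q) - ln (real n) - C - 4 * ln (real n) / ln (real T)"
        unfolding C_def using elim assms T by (intro ln_average_order_ge) auto
      then have "a n \<ge> - C - c / 2 * ln (real n)" using T'[OF elim(2)] unfolding a_def by linarith
      moreover have "C \<le> c / 2 * ln (real n)" using elim(1) c by (simp add: field_simps)
      ultimately have "a n \<ge> - (c * ln (real n))" by linarith
      moreover have "0 \<le> c * ln (real n)" using c elim(2) by simp
      moreover have "norm (ln (real n)) = ln (real n)" using elim(2) by simp
      ultimately show ?case unfolding e_def by simp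
    qed
  qed
  moreover have "real n * ln (real q) - ln (real n) + e n \<le> ln (average_order (unitary_group n (B n)))" for n
    unfolding e_def a_def by linarith
  ultimately show ?thesis by blast
qed

end
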